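(* Let $d\ge1$, $\gamma>1$, $\alpha\in(0,1]$ and $E\subset[0,1]$. Suppose that $E$ has bounded $(\alpha,(\gamma-1)/\gamma)$-Assouad characteristic, i.e. $[E]_{\alpha,(\gamma-1)/\gamma}<\infty$. Then, for any $s\ge(\alpha-\gamma)/2$, there exists a constant $C$ such that for all $f\in H^s(\mathbb R^d)$ $$\sup_{j\ge1}\|U_t^\gamma P_jf\|_{L^2_t(E(2^{-\gamma j});L^2_x(\mathbb B^d))}+\|U_t^\gamma P_{\le0}f\|_{L^2_t(E(1);L^2_x(\mathbb B^d))}\le C\|f\|_{H^s}.$$
   Context: For $\gamma>0$, $U_t^\gamma f(x)=e^{it(-\Delta)^{\gamma/2}}f(x)=(2\pi)^{-d}\int_{\mathbb R^d}e^{i(\langle x,\xi\rangle+t|\xi|^\gamma)}\widehat f(\xi)\,d\xi$, with $\widehat f(\xi)=\int e^{-i\langle x,\xi\rangle}f(x)\,dx$. $\mathbb B^d$ is a unit ball in $\mathbb R^d$. Littlewood--Paley projections: $\psi\in C_c^\infty((1/4,2))$ is a fixed function with $\sum_{j\in\mathbb Z}\psi(2^{-j}\rho)=1$ for all $\rho>0$; $\widehat{P_jf}(\xi)=\psi(2^{-j}|\xi|)\widehat f(\xi)$ and $P_{\le0}=\mathrm{Id}-\sum_{j\ge1}P_j$. $\|f\|_{H^s}^2=\int(1+|\xi|^2)^s|\widehat f(\xi)|^2\,d\xi$. $E(\delta)=\{t\in\mathbb R:\operatorname{dist}(t,E)<\delta\}$. $\|u\|_{L^2_t(A;L^2_x(\mathbb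 B^d))}$ is the $L^2(A,dt)$ norm of $t\mapsto\|u(\cdot,t)\|_{L^2(\mathbb B^d)}$. $N(A,\delta)$ is the minimal number of intervals of length $\delta$ needed to cover $A$. For $\theta\in(0,1)$, $$[E]_{\alpha,\theta}=\sup_I\Big(\frac{|I|^{1/\theta}}{|I|}\Big)^\alpha N\big(E\cap I,|I|^{1/\theta}\big),$$ where $I$ ranges over intervals (of positive length) contained in $[0,1]$. *)

theory Defs
  imports "HOL-Analysis.Analysis"
begin

section \<open>Smooth functions, Schwartz functions and tempered distributions\<close>

definition partial_deriv :: "'a::euclidean_space \<Rightarrow> ('a \<Rightarrow> complex) \<Rightarrow> 'a \<Rightarrow> complex" where
  "partial_deriv b f = (\<lambda>x. frechet_derivative f (at x) b)"

fun iter_partial :: "'a::euclidean_space list \<Rightarrow> ('a \<Rightarrow> complex) \<Rightarrow> 'a \<Rightarrow> complex" where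
  "iter_partial [] f = f"
| "iter_partial (b # bs) f = partial_deriv b (iter_partial bs f)"

definition smooth :: "('a::euclidean_space \<Rightarrow> complex) \<Rightarrow> bool" where
  "smooth f \<longleftrightarrow> (\<forall>bs x. set bs \<subseteq> Basis \<longrightarrow> iter_partial bs f differentiable (at x))"

definition schwartz :: "('a::euclidean_space \<Rightarrow> complex) \<Rightarrow> bool" where
  "schwartz \<phi> \<longleftrightarrow> smooth \<phi> \<and>
     (\<forall>bs k. set bs \<subseteq> Basis \<longrightarrow>
        bounded (range (\<lambda>x. (1 + norm x) ^ k *\<^sub>R iter_partial bs \<phi> x)))"

definition schwartz_norm :: "nat \<Rightarrow> ('a::euclidean_space \<Rightarrow> complex) \<Rightarrow> real" where
  "schwartz_norm N \<phi> =
     (SUP (bs, x) \<in> {bs. set bs \<subseteq> Basis \<and> length bs \<le> N} \<times> UNIV.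
        (1 + norm x) ^ N * norm (iter_partial bs \<phi> x))"

text \<open>A distribution is a functional on all functions of which only the values on Schwartz
  functions are meaningful.\<close>

type_synonym 'a distr = "('a \<Rightarrow> complex) \<Rightarrow> complex"

definition tempered :: "'a::euclidean_space distr \<Rightarrow> bool" where
  "tempered u \<longleftrightarrow>
     (\<forall>\<phi> \<eta>. schwartz \<phi> \<longrightarrow> schwartz \<eta> \<longrightarrow> u (\<lambda>x. \<phi> x + \<eta> x) = u \<phi> + u \<eta>) \<and>
     (\<forall>c \<phi>. schwartz \<phi> \<longrightarrow> u (\<lambda>x. c * \<phi> x) = c * u \<phi>) \<and>
     (\<exists>C N. \<forall>\<phi>. schwartz \<phi> \<longrightarrow> norm (u \<phi>) \<le> C * schwartz_norm N \<phi>)"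

section \<open>Fourier transform and Sobolev spaces\<close>

definition fourier :: "('a::euclidean_space \<Rightarrow> complex) \<Rightarrow> 'a \<Rightarrow> complex" where
  "fourier \<phi> \<xi> = (LINT x|lborel. exp (- \<i> * complex_of_real (x \<bullet> \<xi>)) * \<phi> x)"

text \<open>The Fourier transform of a tempered distribution \<open>u\<close> is \<open>\<phi> \<mapsto> u (fourier \<phi>)\<close>;
  the following says that it is given by the function \<open>g\<close>.\<close>

definition fourier_is_fun :: "'a::euclidean_space distr \<Rightarrow> ('a \<Rightarrow> complex) \<Rightarrow> bool" where
  "fourier_is_fun u g \<longleftrightarrow> g \<in> borel_measurable lborel \<and>
     (\<forall>\<phi>. schwartz \<phi> \<longrightarrow>
        integrable lborel (\<lambda>\<xi>. g \<xi> * \<phi> \<xi>) \<and>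
        u (fourier \<phi>) = (LINT \<xi>|lborel. g \<xi> * \<phi> \<xi>))"

text \<open>Such a \<open>g\<close> is unique up to a null set, and all uses below are insensitive to the choice
  of representative.\<close>

definition fourier_fun :: "'a::euclidean_space distr \<Rightarrow> 'a \<Rightarrow> complex" where
  "fourier_fun u = (SOME g. fourier_is_fun u g)"

definition ennsqrt :: "ennreal \<Rightarrow> ennreal" where
  "ennsqrt a = (if a = \<infinity> then \<infinity> else ennreal (sqrt (enn2real a)))"

definition sobolev_norm :: "real \<Rightarrow> 'a::euclidean_space distr \<Rightarrow> ennreal" where
  "sobolev_norm s u =
     ennsqrt (\<integral>\<^sup>+ \<xi>. ennreal ((1 + (norm \<xi>)\<^sup>2) powr s * (norm (fourier_fun u \<xi>))\<^sup>2) \<partial>lborel)"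

text \<open>The exponent \<open>s\<close> may be negative, so elements are distributions in general.\<close>

definition sobolev_space :: "real \<Rightarrow> 'a::euclidean_space distr set" where
  "sobolev_space s =
     {u. tempered u \<and> (\<exists>g. fourier_is_fun u g) \<and> sobolev_norm s u < \<infinity>}"

section \<open>Littlewood--Paley projections and the propagator\<close>

definition littlewood_paley :: "(real \<Rightarrow> complex) \<Rightarrow> bool" where
  "littlewood_paley \<psi> \<longleftrightarrow> smooth \<psi> \<and>
     compact (closure {\<rho>. \<psi> \<rho> \<noteq> 0}) \<and> closure {\<rho>. \<psi> \<rho> \<noteq> 0} \<subseteq> {1/4<..<2} \<and>
     (\<forall>\<rho>>0. ((\<lambda>j::int. \<psi> (2 powr (- of_int j) * \<rho>)) has_sum 1) UNIV)"

text \<open>\<open>P_hat \<psi> j u\<close> and \<open>P_le0_hat \<psi> u\<close> are the Fourier transforms of \<open>P\<^sub>j u\<close> and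
  \<open>P\<^bsub>\<le>0\<^esub> u\<close>. The sum in the latter has finitely many nonzero terms for each \<open>\<xi>\<close>.\<close>

definition P_hat :: "(real \<Rightarrow> complex) \<Rightarrow> int \<Rightarrow> 'a::euclidean_space distr \<Rightarrow> 'a \<Rightarrow> complex" where
  "P_hat \<psi> j u \<xi> = \<psi> (2 powr (- of_int j) * norm \<xi>) * fourier_fun u \<xi>"

definition P_le0_hat :: "(real \<Rightarrow> complex) \<Rightarrow> 'a::euclidean_space distr \<Rightarrow> 'a \<Rightarrow> complex" where
  "P_le0_hat \<psi> u \<xi> = fourier_fun u \<xi> - (\<Sum>\<^sub>\<infinity>j\<in>{1..}. P_hat \<psi> j u \<xi>)"

text \<open>\<open>propagator \<gamma> t g\<close> is \<open>U\<^sub>t\<^sup>\<gamma> f\<close> for the \<open>f\<close> with Fourier transform \<open>g\<close>. It is only applied to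
  the frequency-localised pieces above, which have compact support and are square integrable
  for \<open>u\<close> in a Sobolev space, so that the integral converges absolutely.\<close>

definition propagator :: "real \<Rightarrow> real \<Rightarrow> ('a::euclidean_space \<Rightarrow> complex) \<Rightarrow> 'a \<Rightarrow> complex" where
  "propagator \<gamma> t g x =
     complex_of_real ((2 * pi) powr (- real DIM('a))) *
     (LINT \<xi>|lborel. exp (\<i> * complex_of_real (x \<bullet> \<xi> + t * norm \<xi> powr \<gamma>)) * g \<xi>)"

definition L2_norm_on :: "'a::euclidean_space set \<Rightarrow> ('a \<Rightarrow> ennreal) \<Rightarrow> ennreal" where
  "L2_norm_on A F = ennsqrt (\<integral>\<^sup>+ x\<in>A. (F x)\<^sup>2 \<partial>lborel)"

definition mixed_norm ::
    "real set \<Rightarrow> 'a::euclidean_space set \<Rightarrow> (real \<Rightarrow> 'a \<Rightarrow> complex) \<Rightarrow> ennreal" where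
  "mixed_norm A B v = L2_norm_on A (\<lambda>t. L2_norm_on B (\<lambda>x. ennreal (norm (v t x))))"

section \<open>Neighbourhoods and the Assouad characteristic\<close>

text \<open>\<open>infdist t {} = 0\<close> in the library, whereas the distance to the empty set should be infinite.\<close>

definition nbhd :: "real set \<Rightarrow> real \<Rightarrow> real set" where
  "nbhd E \<delta> = {t. E \<noteq> {} \<and> infdist t E < \<delta>}"

text \<open>Only used for bounded \<open>A\<close> and \<open>\<delta> > 0\<close>, where the set of cardinalities is nonempty and
  the intervals \<open>J\<close> are bounded.\<close>

definition covering_number :: "real set \<Rightarrow> real \<Rightarrow> nat" where
  "covering_number A \<delta> =
     (LEAST n. \<exists>F. finite F \<and> card F = n \<and>
        (\<forall>J\<in>F. is_interval J \<and> measure lborel J = \<delta>) \<and> A \<subseteq> \<Union>F)"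

definition assouad_char :: "real \<Rightarrow> real \<Rightarrow> real set \<Rightarrow> ennreal" where
  "assouad_char \<alpha> \<theta> E =
     (SUP I \<in> {I. is_interval I \<and> I \<subseteq> {0..1} \<and> 0 < measure lborel I}.
        ennreal ((measure lborel I powr (1 / \<theta>) / measure lborel I) powr \<alpha> *
          real (covering_number (E \<inter> I) (measure lborel I powr (1 / \<theta>)))))"

end

theory Submission
  imports Defs "HOL-Probability.Sinc_Integral"
begin

text \<open>Write \<open>F\<close> for the evolution of a function with Fourier transform \<open>g\<close> supported at frequencies of
  size \<open>\<Lambda>\<close>, and let \<open>\<beta>\<close> be a weight bounded below on the ball whose Fourier transform has small
  compact support. Then \<open>h t = \<integral> \<beta> \<bar>F t\<bar>\<^sup>2\<close> is a quadratic form in \<open>g\<close> that only involves time frequencies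
  \<open>\<bar>\<xi>\<bar>\<^sup>\<gamma> - \<bar>\<eta>\<bar>\<^sup>\<gamma>\<close> with \<open>\<bar>\<xi> - \<eta>\<bar>\<close> small, which are at most \<open>R \<sim> \<Lambda>\<^bsup>\<gamma> - 1\<^esup>\<close>. Hence \<open>h\<close> reproduces under
  convolution with a kernel at scale \<open>1 / R\<close>, and integrating \<open>h\<close> over a set \<open>A\<close> costs at most
  \<open>M R \<integral> h\<close> if \<open>A\<close> meets intervals of length \<open>1 / R\<close> in measure at most \<open>M\<close>. Local smoothing,
  \<open>\<integral> h \<lesssim> \<parallel>g\<parallel>\<^sup>2 / R\<close>, follows from Schur's test, since the shells \<open>\<bar>\<bar>\<eta>\<bar>\<^sup>\<gamma> - \<bar>\<xi>\<bar>\<^sup>\<gamma>\<bar> \<le> \<epsilon>\<close> near \<open>\<xi>\<close> have measure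
  of order \<open>\<epsilon> / R\<close>. For the neighbourhood of \<open>E\<close> of width \<open>\<Lambda>\<^bsup>-\<gamma>\<^esup>\<close>, the Assouad characteristic at exactly
  the interval length \<open>1 / R\<close> gives \<open>M \<sim> \<Lambda>\<^bsup>\<alpha> - \<gamma>\<^esup>\<close>.\<close>

section \<open>The Fejer and de la Vallee-Poussin kernels\<close>

text \<open>This is \<open>2 * (sin (s / 2))\<^sup>2 / s\<^sup>2\<close>, the Fejer kernel up to
  normalisation, continued to 0 by its limit 1/2.\<close>

definition fejer :: "real \<Rightarrow> real" where
  "fejer s = (if s = 0 then 1 / 2 else (1 - cos s) / s\<^sup>2)"

lemma borel_measurable_fejer [measurable]: "fejer \<in> borel_measurable borel"
  unfolding fejer_def [abs_def] by measurable

lemma fejer_nonneg: "0 \<le> fejer s"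
  by (simp add: fejer_def)

lemma fejer_minus: "fejer (- s) = fejer s"
  by (simp add: fejer_def)

lemma one_minus_cos_eq: "1 - cos s = 2 * (sin (s / 2))\<^sup>2" for s :: real
  using cos_double_sin [of "s / 2"] by simp

lemma one_minus_cos_le: "1 - cos s \<le> s\<^sup>2 / 2" for s :: real
proof -
  have "\<bar>sin (s / 2)\<bar> \<le> \<bar>s / 2\<bar>"
    by (rule abs_sin_x_le_abs_x)
  then have "(sin (s / 2))\<^sup>2 \<le> (s / 2)\<^sup>2"
    by (simp only: abs_le_square_iff)
  then show ?thesis
    by (simp add: one_minus_cos_eq power_divide)
qed

text \<open>The quadratic bound on \<open>1 - cos s\<close> controls the kernel near 0, the trivial
  bound 2 controls it at infinity.\<close>

lemma fejer_le: "fejer s \<le> 4 / (1 + s\<^sup>2)"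
proof (cases "s = 0")
  case False
  have "(1 - cos s) * (1 + s\<^sup>2) = (1 - cos s) + (1 - cos s) * s\<^sup>2"
    by (simp add: algebra_simps)
  also have "\<dots> \<le> s\<^sup>2 / 2 + 2 * s\<^sup>2"
    using one_minus_cos_le [of s] cos_ge_minus_one [of s]
    by (intro add_mono mult_right_mono) auto
  also have "\<dots> \<le> 4 * s\<^sup>2"
    by simp
  finally show ?thesis
    using False by (simp add: fejer_def field_simps add_pos_nonneg)
qed (simp add: fejer_def)

lemma half_le_sin: "y / 2 \<le> sin y" if "0 \<le> y" "y \<le> 1 / 2" for y :: real
proof (cases "y = 0")
  case False
  then have "\<exists>x>0. x < y \<and> sin y - sin 0 = (y - 0) * cos x"
    using that by (intro MVT2) (auto intro: DERIV_sin)
  then obtain x where x: "0 < x" "x < y" "sin y = y * cos x"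
    by auto
  have "x\<^sup>2 \<le> 1"
    using x that by (simp add: power2_eq_square mult_le_one)
  then have "1 / 2 \<le> cos x"
    using one_minus_cos_le [of x] by simp
  then have "y * (1 / 2) \<le> y * cos x"
    using that by (intro mult_left_mono)
  then show ?thesis
    using x by simp
qed simp

text \<open>This lower bound serves twice: in space it keeps the bump of
  \<open>exists_bandlimited_bump\<close> away from 0 on the ball, in time it lets dilated kernels
  dominate the cutoffs in \<open>local_smoothing\<close>.\<close>

lemma fejer_lower: "1 / 8 \<le> fejer s" if "\<bar>s\<bar> \<le> 1"
proof (cases "s = 0")
  case False
  have "\<bar>s\<bar> / 4 \<le> sin (\<bar>s\<bar> / 2)"
    using half_le_sin [of "\<bar>s\<bar> / 2"] that by simp
  then have "(\<bar>s\<bar> / 4)\<^sup>2 \<le> (sin (\<bar>s\<bar> / 2))\<^sup>2"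
    by (intro power_mono) auto
  also have "(sin (\<bar>s\<bar> / 2))\<^sup>2 = (sin (s / 2))\<^sup>2"
    by (cases "s \<ge> 0") auto
  finally show ?thesis
    using False by (simp add: fejer_def one_minus_cos_eq field_simps)
qed (simp add: fejer_def)

lemma integrable_inverse_1_plus_square_lborel: "integrable lborel (\<lambda>x::real. 1 / (1 + x\<^sup>2))"
  using integrable_inverse_1_plus_square by (simp add: set_integrable_def inverse_eq_divide)

lemma integrable_fejer: "integrable lborel fejer"
proof (rule Bochner_Integration.integrable_bound)
  show "integrable lborel (\<lambda>s::real. 4 * (1 / (1 + s\<^sup>2)))"
    by (intro integrable_mult_right integrable_inverse_1_plus_square_lborel)
  show "AE s in lborel. norm (fejer s) \<le> norm (4 * (1 / (1 + s\<^sup>2)))"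
    using fejer_le fejer_nonneg by (auto intro!: AE_I2 simp: abs_of_nonneg)
qed simp

text \<open>Its value is \<pi>, but it is kept as a symbol: normalising by it only requires that it
  be positive.\<close>

definition fejer_mass :: real where
  "fejer_mass = (LINT s|lborel. fejer s)"

lemma fejer_mass_pos: "0 < fejer_mass"
proof -
  have "0 < (LINT s|lborel. 1 / 8 * indicator {0..1::real} s :: real)"
    by simp
  also have "\<dots> \<le> fejer_mass"
    unfolding fejer_mass_def
    by (intro integral_mono integrable_fejer integrable_mult_right integrable_real_indicator)
       (use fejer_lower in \<open>auto simp: indicator_def fejer_nonneg\<close>)
  finally show ?thesis .
qed

section \<open>Fourier transforms of the Fejer and de la Vallee-Poussin kernels\<close>

text \<open>Dilation of \<open>fejer\<close> by \<open>a\<close>; the factor \<bar>a\<bar> is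
  \<open>a\<^sup>2\<close> divided by the Jacobian.\<close>

lemma has_bochner_integral_one_minus_cos:
  "has_bochner_integral lborel (\<lambda>s. (1 - cos (a * s)) / s\<^sup>2) (\<bar>a\<bar> * fejer_mass)"
proof (cases "a = 0")
  case False
  have "has_bochner_integral lborel (\<lambda>s. fejer (0 + a * s)) (fejer_mass /\<^sub>R \<bar>a\<bar>)"
    using False integrable_fejer
    by (subst lborel_has_bochner_integral_real_affine_iff [symmetric])
       (auto simp: has_bochner_integral_iff fejer_mass_def)
  then have "has_bochner_integral lborel (\<lambda>s. a\<^sup>2 * fejer (0 + a * s)) (a\<^sup>2 * (fejer_mass /\<^sub>R \<bar>a\<bar>))"
    by (rule has_bochner_integral_mult_right)
  also have "a\<^sup>2 * (fejer_mass /\<^sub>R \<bar>a\<bar>) = \<bar>a\<bar> * fejer_mass"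
    using False by (simp add: power2_eq_square field_simps abs_mult_self_eq)
  \<comment> \<open>At \<open>s = 0\<close> the quotient is 0 by the convention for division while
    \<open>fejer\<close> is 1/2, so the integrands agree only off a null set.\<close>
  also have "has_bochner_integral lborel (\<lambda>s. a\<^sup>2 * fejer (0 + a * s)) (\<bar>a\<bar> * fejer_mass) \<longleftrightarrow> ?thesis"
    using False AE_lborel_singleton [of 0]
    by (intro has_bochner_integral_cong_AE) (auto simp: fejer_def field_simps elim!: eventually_mono)
  finally show ?thesis .
qed (simp add: has_bochner_integral_zero)

text \<open>The Fourier transform of the Fejer kernel is a triangle: all three terms of the
  product-to-sum formula are instances of the preceding integral.\<close>

lemma has_bochner_integral_fejer_cos:
  "has_bochner_integral lborel (\<lambda>s. fejer s * cos (\<tau> * s)) (fejer_mass * max 0 (1 - \<bar>\<tau>\<bar>))"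
proof -
  let ?J = "\<lambda>a s::real. (1 - cos (a * s)) / s\<^sup>2"
  have "has_bochner_integral lborel (\<lambda>s. 1 / 2 * ?J (1 + \<tau>) s + 1 / 2 * ?J (1 - \<tau>) s - ?J \<tau> s)
     (1 / 2 * (\<bar>1 + \<tau>\<bar> * fejer_mass) + 1 / 2 * (\<bar>1 - \<tau>\<bar> * fejer_mass) - \<bar>\<tau>\<bar> * fejer_mass)"
    by (intro has_bochner_integral_diff has_bochner_integral_add has_bochner_integral_mult_right
        has_bochner_integral_one_minus_cos)
  also have "1 / 2 * (\<bar>1 + \<tau>\<bar> * fejer_mass) + 1 / 2 * (\<bar>1 - \<tau>\<bar> * fejer_mass) - \<bar>\<tau>\<bar> * fejer_mass
      = fejer_mass * (\<bar>1 + \<tau>\<bar> / 2 + \<bar>1 - \<tau>\<bar> / 2 - \<bar>\<tau>\<bar>)"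
    by (simp add: algebra_simps)
  \<comment> \<open>Half the second difference of the absolute value, with step 1, is the
    triangle.\<close>
  also have "\<bar>1 + \<tau>\<bar> / 2 + \<bar>1 - \<tau>\<bar> / 2 - \<bar>\<tau>\<bar> = max 0 (1 - \<bar>\<tau>\<bar>)"
    by (auto simp: max_def abs_if field_simps)
  finally have *: "has_bochner_integral lborel (\<lambda>s. 1 / 2 * ?J (1 + \<tau>) s + 1 / 2 * ?J (1 - \<tau>) s - ?J \<tau> s)
     (fejer_mass * max 0 (1 - \<bar>\<tau>\<bar>))" .
  have "1 / 2 * ?J (1 + \<tau>) s + 1 / 2 * ?J (1 - \<tau>) s - ?J \<tau> s = fejer s * cos (\<tau> * s)"
    if "s \<noteq> 0" for s
  proof -
    have "1 / 2 * ?J (1 + \<tau>) s + 1 / 2 * ?J (1 - \<tau>) s - ?J \<tau> s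
       = (cos (\<tau> * s) - (cos (s + \<tau> * s) + cos (s - \<tau> * s)) / 2) / s\<^sup>2"
      using that by (simp add: field_simps)
    also have "cos (s + \<tau> * s) + cos (s - \<tau> * s) = 2 * (cos s * cos (\<tau> * s))"
      by (simp add: cos_add cos_diff)
    finally show ?thesis
      using that by (simp add: fejer_def field_simps)
  qed
  then have "has_bochner_integral lborel (\<lambda>s. 1 / 2 * ?J (1 + \<tau>) s + 1 / 2 * ?J (1 - \<tau>) s - ?J \<tau> s)
     (fejer_mass * max 0 (1 - \<bar>\<tau>\<bar>)) \<longleftrightarrow> ?thesis"
    using AE_lborel_singleton [of 0]
    by (intro has_bochner_integral_cong_AE) (auto elim!: eventually_mono)
  with * show ?thesis
    by blast
qed

lemma has_bochner_integral_fejer_cis: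
  "has_bochner_integral lborel (\<lambda>s. complex_of_real (fejer s) * cis (\<tau> * s))
     (complex_of_real (fejer_mass * max 0 (1 - \<bar>\<tau>\<bar>)))"
proof -
  have int: "integrable lborel (\<lambda>s. fejer s * sin (\<tau> * s))"
    by (rule Bochner_Integration.integrable_bound [OF integrable_fejer])
       (auto simp: abs_mult fejer_nonneg intro!: mult_left_le)
  \<comment> \<open>The kernel is even, so reflection turns the sine integral into its own
    negative.\<close>
  have "(LINT s|lborel. fejer s * sin (\<tau> * s)) = - (LINT s|lborel. fejer s * sin (\<tau> * s))"
    by (subst lborel_integral_real_affine [of "-1" _ 0]) (simp_all add: fejer_minus)
  then have "has_bochner_integral lborel (\<lambda>s. fejer s * sin (\<tau> * s)) 0"
    using int by (simp add: has_bochner_integral_iff)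
  then have "has_bochner_integral lborel (\<lambda>s. complex_of_real (fejer s * cos (\<tau> * s))
      + \<i> * complex_of_real (fejer s * sin (\<tau> * s)))
      (complex_of_real (fejer_mass * max 0 (1 - \<bar>\<tau>\<bar>)) + \<i> * complex_of_real 0)"
    by (intro has_bochner_integral_add has_bochner_integral_mult_right
        has_bochner_integral_of_real has_bochner_integral_fejer_cos)
  moreover have "complex_of_real (fejer s * cos (\<tau> * s)) + \<i> * complex_of_real (fejer s * sin (\<tau> * s))
      = complex_of_real (fejer s) * cis (\<tau> * s)" for s
    by (simp add: complex_eq_iff)
  ultimately show ?thesis
    by simp
qed

lemma has_bochner_integral_fejer_scaled:
  assumes "a > 0"
  shows "has_bochner_integral lborel (\<lambda>s. complex_of_real (fejer (a * s)) * cis (\<tau> * s))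
     (complex_of_real (fejer_mass / a * max 0 (1 - \<bar>\<tau>\<bar> / a)))"
proof -
  have "has_bochner_integral lborel
      (\<lambda>s. complex_of_real (fejer (0 + a * s)) * cis (\<tau> / a * (0 + a * s)))
      (complex_of_real (fejer_mass * max 0 (1 - \<bar>\<tau> / a\<bar>)) /\<^sub>R \<bar>a\<bar>)"
    using assms has_bochner_integral_fejer_cis [of "\<tau> / a"]
    by (subst lborel_has_bochner_integral_real_affine_iff [symmetric]) auto
  moreover have "complex_of_real (fejer_mass * max 0 (1 - \<bar>\<tau> / a\<bar>)) /\<^sub>R \<bar>a\<bar>
     = complex_of_real (fejer_mass / a * max 0 (1 - \<bar>\<tau>\<bar> / a))"
    using assms by (simp add: scaleR_conv_of_real abs_divide field_simps)
  ultimately show ?thesis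
    using assms by (simp del: of_real_mult of_real_divide)
qed

text \<open>The de la Vallee-Poussin kernel: its Fourier transform is the difference of two triangles,
  hence \<open>1\<close> on \<open>[-1, 1]\<close>.\<close>

definition dlvp :: "real \<Rightarrow> real" where
  "dlvp s = (4 * fejer (2 * s) - fejer s) / fejer_mass"

lemma borel_measurable_dlvp [measurable]: "dlvp \<in> borel_measurable borel"
  unfolding dlvp_def [abs_def] by measurable

text \<open>The kernel takes both signs, so size estimates go through this integrable
  majorant.\<close>

lemma dlvp_bound: "\<bar>dlvp s\<bar> \<le> 20 / fejer_mass / (1 + s\<^sup>2)"
proof -
  have "fejer (2 * s) \<le> 4 / (1 + (2 * s)\<^sup>2)"
    by (rule fejer_le)
  also have "\<dots> \<le> 4 / (1 + s\<^sup>2)"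
    by (intro divide_left_mono mult_pos_pos add_pos_nonneg) (auto simp: power_mult_distrib)
  finally have "4 * fejer (2 * s) + fejer s \<le> 20 / (1 + s\<^sup>2)"
    using fejer_le [of s] by simp
  moreover have "\<bar>4 * fejer (2 * s) - fejer s\<bar> \<le> 4 * fejer (2 * s) + fejer s"
    using fejer_nonneg [of s] fejer_nonneg [of "2 * s"] by linarith
  ultimately have "\<bar>4 * fejer (2 * s) - fejer s\<bar> / fejer_mass \<le> 20 / (1 + s\<^sup>2) / fejer_mass"
    using fejer_mass_pos by (intro divide_right_mono) auto
  then show ?thesis
    using fejer_mass_pos by (simp add: dlvp_def field_simps)
qed

text \<open>For \<bar>\<tau>\<bar> \<le> R both triangles are on their linear part, and their slopes
  cancel: \<open>2 * (1 - \<bar>\<tau>\<bar> / (2 * R)) - (1 - \<bar>\<tau>\<bar> / R) =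
  1\<close>.\<close>

lemma has_bochner_integral_dlvp:
  assumes R: "R > 0" and \<tau>: "\<bar>\<tau>\<bar> \<le> R"
  shows "has_bochner_integral lborel (\<lambda>s. complex_of_real (R * dlvp (R * s)) * cis (\<tau> * s)) 1"
proof -
  let ?c = "complex_of_real (R / fejer_mass)"
  have "has_bochner_integral lborel (\<lambda>s.
       ?c * (4 * (complex_of_real (fejer (2 * R * s)) * cis (\<tau> * s))
          - complex_of_real (fejer (R * s)) * cis (\<tau> * s)))
     (?c * (4 * complex_of_real (fejer_mass / (2 * R) * max 0 (1 - \<bar>\<tau>\<bar> / (2 * R)))
          - complex_of_real (fejer_mass / R * max 0 (1 - \<bar>\<tau>\<bar> / R))))"
    using R by (intro has_bochner_integral_mult_right has_bochner_integral_diff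
        has_bochner_integral_fejer_scaled) auto
  moreover have "max 0 (1 - \<bar>\<tau>\<bar> / (2 * R)) = 1 - \<bar>\<tau>\<bar> / (2 * R)" "max 0 (1 - \<bar>\<tau>\<bar> / R) = 1 - \<bar>\<tau>\<bar> / R"
    using R \<tau> by (auto simp: max_def field_simps)
  moreover have "?c * (4 * complex_of_real (fejer_mass / (2 * R) * (1 - \<bar>\<tau>\<bar> / (2 * R)))
          - complex_of_real (fejer_mass / R * (1 - \<bar>\<tau>\<bar> / R)))
     = complex_of_real (R / fejer_mass * (4 * (fejer_mass / (2 * R) * (1 - \<bar>\<tau>\<bar> / (2 * R)))
          - fejer_mass / R * (1 - \<bar>\<tau>\<bar> / R)))"
    by simp
  moreover have "R / fejer_mass * (4 * (fejer_mass / (2 * R) * (1 - \<bar>\<tau>\<bar> / (2 * R)))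
          - fejer_mass / R * (1 - \<bar>\<tau>\<bar> / R)) = 1"
    using R fejer_mass_pos by (simp add: field_simps)
  moreover have "?c * (4 * (complex_of_real (fejer (2 * R * s)) * cis (\<tau> * s))
          - complex_of_real (fejer (R * s)) * cis (\<tau> * s)) =
     complex_of_real (R * dlvp (R * s)) * cis (\<tau> * s)" for s
    by (simp add: dlvp_def algebra_simps diff_divide_distrib)
  ultimately show ?thesis
    by (simp only: of_real_1)
qed

section \<open>Quadratic forms and band-limited weights\<close>

lemma borel_measurable_cis [measurable (raw)]:
  "f \<in> borel_measurable M \<Longrightarrow> (\<lambda>x. cis (f x)) \<in> borel_measurable M"
  unfolding cis_conv_exp by measurable

lemma borel_measurable_cnj [measurable (raw)]:
  "f \<in> borel_measurable M \<Longrightarrow> (\<lambda>x. cnj (f x)) \<in> borel_measurable M"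
  by (rule borel_measurable_continuous_on [OF continuous_on_cnj [OF continuous_on_id]])

section \<open>Integrals of products over coordinates and over pairs of variables\<close>

text \<open>Lebesgue measure is the image of the product measure over the coordinates, so integrals
  of products of one-variable functions factor.\<close>

lemma
  fixes f :: "'a::euclidean_space \<Rightarrow> real \<Rightarrow> 'b::{real_normed_field,banach,second_countable_topology}"
  assumes f: "\<And>b. b \<in> Basis \<Longrightarrow> integrable lborel (f b)"
  shows integrable_lborel_prod: "integrable lborel (\<lambda>x. \<Prod>b\<in>Basis. f b (x \<bullet> b))"
    and integral_lborel_prod:
      "(LINT x|lborel. (\<Prod>b\<in>Basis. f b (x \<bullet> b))) = (\<Prod>b\<in>Basis. LINT s|lborel. f b s)"
proof -
  interpret product_sigma_finite "\<lambda>_::'a. lborel :: real measure" ..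
  let ?h = "\<lambda>v. \<Sum>b\<in>Basis. v b *\<^sub>R b :: 'a"
  have h: "?h \<in> (\<Pi>\<^sub>M b\<in>Basis. lborel) \<rightarrow>\<^sub>M borel"
    by measurable
  have [measurable]: "f b \<in> borel_measurable borel" if "b \<in> Basis" for b
    using borel_measurable_integrable [OF f [OF that]] by simp
  have m: "(\<lambda>x. \<Prod>b\<in>Basis. f b (x \<bullet> b)) \<in> borel_measurable borel"
    by measurable
  have e: "(\<Prod>b\<in>Basis. f b (?h v \<bullet> b)) = (\<Prod>b\<in>Basis. f b (v b))" for v
    by (intro prod.cong) auto
  show "integrable lborel (\<lambda>x. \<Prod>b\<in>Basis. f b (x \<bullet> b))"
    by (subst lborel_eq, subst integrable_distr_eq [OF h m])
       (auto simp only: e finite_Basis intro!: product_integrable_prod f)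
  show "(LINT x|lborel. (\<Prod>b\<in>Basis. f b (x \<bullet> b))) = (\<Prod>b\<in>Basis. LINT s|lborel. f b s)"
    by (subst lborel_eq, subst integral_distr [OF h m])
       (auto simp only: e finite_Basis intro!: product_integral_prod f)
qed

lemma
  fixes f :: "'a::euclidean_space \<Rightarrow> 'c::{real_normed_field,banach,second_countable_topology}"
    and g :: "'b::euclidean_space \<Rightarrow> 'c"
  assumes f: "integrable lborel f" and g: "integrable lborel g"
  shows integrable_lborel_tensor: "integrable lborel (\<lambda>p. f (fst p) * g (snd p))"
    and integral_lborel_tensor:
      "(LINT p|lborel. f (fst p) * g (snd p)) = (LINT x|lborel. f x) * (LINT y|lborel. g y)"
proof -
  have [measurable]: "f \<in> borel_measurable borel" "g \<in> borel_measurable borel"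
    using f g by (auto dest: borel_measurable_integrable)
  have *: "integrable (lborel \<Otimes>\<^sub>M lborel) (\<lambda>p. f (fst p) * g (snd p))"
    using f g by (intro lborel_pair.Fubini_integrable)
      (auto simp: norm_mult intro!: integrable_mult_left integrable_norm integrable_mult_right)
  then show "integrable lborel (\<lambda>p. f (fst p) * g (snd p))"
    by (simp add: lborel_prod)
  show "(LINT p|lborel. f (fst p) * g (snd p)) = (LINT x|lborel. f x) * (LINT y|lborel. g y)"
    using lborel_pair.integral_fst' [OF *] by (simp add: lborel_prod)
qed

section \<open>Weighted square integrals as quadratic forms on the frequency side\<close>

text \<open>The square \<open>(norm (T y))\<^sup>2 = T y * cnj (T y)\<close> is a double integral
  over two frequencies, and Fubini moves the integral in \<open>y\<close> inside. The general
  unimodular \<open>e\<close> covers both space-time integrals, with \<open>y\<close> a pair of time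
  and position, and integrals over space at a fixed time.\<close>

lemma
  fixes e :: "'y::euclidean_space \<Rightarrow> 'x::euclidean_space \<Rightarrow> complex"
    and W :: "'y \<Rightarrow> real" and g :: "'x \<Rightarrow> complex"
  assumes W: "integrable lborel W" and g: "integrable lborel g"
    and e: "(\<lambda>p. e (fst p) (snd p)) \<in> borel_measurable borel" "\<And>y \<xi>. norm (e y \<xi>) = 1"
  defines "T \<equiv> \<lambda>y. LINT \<xi>|lborel. e y \<xi> * g \<xi>"
  shows integrable_quadratic_form: "integrable lborel (\<lambda>y. W y * (norm (T y))\<^sup>2)"
    and integral_quadratic_form:
      "complex_of_real (LINT y|lborel. W y * (norm (T y))\<^sup>2) =
       (LINT p|lborel. g (fst p) * cnj (g (snd p)) *
          (LINT y|lborel. W y * (e y (fst p) * cnj (e y (snd p)))))"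
proof -
  note [measurable] = e(1)
  have [measurable]: "W \<in> borel_measurable borel" "g \<in> borel_measurable borel"
    using W g by (auto dest: borel_measurable_integrable)
  have em: "(\<lambda>x. e (a x) (b x)) \<in> borel_measurable M"
    if [measurable]: "a \<in> borel_measurable M" "b \<in> borel_measurable M" for a b and M :: "'z measure"
    using measurable_compose [of "\<lambda>x. (a x, b x)" M borel, OF _ e(1)] by simp
  have em': "(\<lambda>x. e (a x) (b x)) \<in> borel_measurable M"
    if [measurable]: "a \<in> borel_measurable M" "b \<in> borel_measurable M" for a b and M :: "'x measure"
    using measurable_compose [of "\<lambda>x. (a x, b x)" M borel, OF _ e(1)] by simp
  have "integrable lborel (\<lambda>p. g (fst p) * cnj (g (snd p)))"
    by (rule integrable_lborel_tensor) (use g in auto)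
  then have "integrable lborel (\<lambda>q. complex_of_real (W (fst q)) *
      (g (fst (snd q)) * cnj (g (snd (snd q)))))"
    using W by (intro integrable_lborel_tensor [where f = "\<lambda>y. complex_of_real (W y)"]) auto
  moreover have "(\<lambda>q. complex_of_real (W (fst q)) *
      ((e (fst q) (fst (snd q)) * g (fst (snd q))) * cnj (e (fst q) (snd (snd q)) * g (snd (snd q)))))
      \<in> borel_measurable (borel \<Otimes>\<^sub>M (borel \<Otimes>\<^sub>M borel))"
    by (intro borel_measurable_times borel_measurable_cnj em; measurable)
  \<comment> \<open>Since \<open>e\<close> has modulus 1, this integrand has the same modulus as the
    tensor product above.\<close>
  ultimately have "integrable lborel (\<lambda>q::'y \<times> 'x \<times> 'x. W (fst q) *
      ((e (fst q) (fst (snd q)) * g (fst (snd q))) * cnj (e (fst q) (snd (snd q)) * g (snd (snd q)))))"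
    by (elim Bochner_Integration.integrable_bound) (auto simp: norm_mult e borel_prod)
  then have int: "integrable (lborel \<Otimes>\<^sub>M lborel) (\<lambda>(y, p). W y *
      ((e y (fst p) * g (fst p)) * cnj (e y (snd p) * g (snd p))))"
    by (simp add: lborel_prod split_def)
  have eg: "integrable lborel (\<lambda>\<xi>. e y \<xi> * g \<xi>)" for y
    by (rule Bochner_Integration.integrable_bound [OF g])
       (auto simp: norm_mult e intro!: em' borel_measurable_times)
  have T: "(LINT p|lborel. W y * ((e y (fst p) * g (fst p)) * cnj (e y (snd p) * g (snd p))))
      = complex_of_real (W y * (norm (T y))\<^sup>2)" for y
  proof -
    have "(LINT p|lborel. (e y (fst p) * g (fst p)) * cnj (e y (snd p) * g (snd p))) = T y * cnj (T y)"
      using integral_lborel_tensor [OF eg integrable_cnj [OF eg], of y y]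
      by (simp only: T_def Bochner_Integration.integral_cnj)
    then show ?thesis
      by (simp only: integral_mult_right_zero complex_norm_square of_real_mult)
  qed
  have "integrable lborel (\<lambda>y. complex_of_real (W y * (norm (T y))\<^sup>2))"
    using lborel_pair.integrable_fst' [OF int] by (simp only: prod.case T)
  then show "integrable lborel (\<lambda>y. W y * (norm (T y))\<^sup>2)"
    by (simp only: complex_of_real_integrable_eq)
  have "complex_of_real (LINT y|lborel. W y * (norm (T y))\<^sup>2) =
     (LINT y|lborel. LINT p|lborel. W y * ((e y (fst p) * g (fst p)) * cnj (e y (snd p) * g (snd p))))"
    by (simp only: T integral_complex_of_real)
  also have "\<dots> = (LINT p|lborel. LINT y|lborel.
      W y * ((e y (fst p) * g (fst p)) * cnj (e y (snd p) * g (snd p))))"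
    by (rule lborel_pair.Fubini_integral [OF int, symmetric])
  also have "\<dots> = (LINT p|lborel. LINT y|lborel.
      g (fst p) * cnj (g (snd p)) * (W y * (e y (fst p) * cnj (e y (snd p)))))"
    by (simp add: mult_ac)
  finally show "complex_of_real (LINT y|lborel. W y * (norm (T y))\<^sup>2) =
       (LINT p|lborel. g (fst p) * cnj (g (snd p)) *
          (LINT y|lborel. W y * (e y (fst p) * cnj (e y (snd p)))))"
    by simp
qed

text \<open>The evolution, for a general dispersion relation \<open>p\<close>, of the function with
  Fourier transform \<open>g\<close>. The power of 2 \<pi> is dropped;
  \<open>norm_propagator_le\<close> accounts for it.\<close>

definition osc :: "('a::euclidean_space \<Rightarrow> real) \<Rightarrow> ('a \<Rightarrow> complex) \<Rightarrow> real \<Rightarrow> 'a \<Rightarrow> complex" where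
  "osc p g t x = (LINT \<xi>|lborel. cis (x \<bullet> \<xi> + t * p \<xi>) * g \<xi>)"

lemma integrable_mult_cis:
  fixes f :: "'a::euclidean_space \<Rightarrow> real" and h :: "'a \<Rightarrow> real"
  assumes f: "integrable lborel f" and [measurable]: "h \<in> borel_measurable borel"
  shows "integrable lborel (\<lambda>x. f x * cis (h x))"
proof -
  have [measurable]: "f \<in> borel_measurable borel"
    using f by (auto dest: borel_measurable_integrable)
  show ?thesis
    by (rule Bochner_Integration.integrable_bound [OF f]) (auto simp: norm_mult)
qed

text \<open>For a product weight the kernel of the quadratic form separates: the transform of
  \<open>w\<close> at the difference of the phases times the transform of \<open>\<beta>\<close> at
  the difference of the frequencies.\<close>

lemma
  fixes p :: "'a::euclidean_space \<Rightarrow> real"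
  assumes w: "integrable lborel w" and \<beta>: "integrable lborel \<beta>" and g: "integrable lborel g"
    and p [measurable]: "p \<in> borel_measurable borel"
  shows integrable_osc_square:
      "integrable lborel (\<lambda>y. w (fst y) * \<beta> (snd y) * (norm (osc p g (fst y) (snd y)))\<^sup>2)"
    and integral_osc_square:
      "complex_of_real (LINT y|lborel. w (fst y) * \<beta> (snd y) * (norm (osc p g (fst y) (snd y)))\<^sup>2) =
       (LINT q|lborel. g (fst q) * cnj (g (snd q)) *
          ((LINT t|lborel. w t * cis ((p (fst q) - p (snd q)) * t)) *
           (LINT x|lborel. \<beta> x * cis (x \<bullet> (fst q - snd q)))))"
proof -
  let ?e = "\<lambda>y::real\<times>'a. \<lambda>\<xi>. cis (snd y \<bullet> \<xi> + fst y * p \<xi>)"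
  have W: "integrable lborel (\<lambda>y. w (fst y) * \<beta> (snd y))"
    by (intro integrable_lborel_tensor w \<beta>)
  have e: "(\<lambda>p. ?e (fst p) (snd p)) \<in> borel_measurable borel"
    unfolding borel_prod [symmetric] by measurable
  have e1: "norm (?e y \<xi>) = 1" for y \<xi>
    by simp
  show "integrable lborel (\<lambda>y. w (fst y) * \<beta> (snd y) * (norm (osc p g (fst y) (snd y)))\<^sup>2)"
    unfolding osc_def by (rule integrable_quadratic_form [OF W g e e1])
  have "(LINT y|lborel. complex_of_real (w (fst y) * \<beta> (snd y)) * (?e y \<xi> * cnj (?e y \<eta>))) =
     (LINT t|lborel. w t * cis ((p \<xi> - p \<eta>) * t)) * (LINT x|lborel. \<beta> x * cis (x \<bullet> (\<xi> - \<eta>)))" for \<xi> \<eta>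
  proof -
    have "complex_of_real (w (fst y) * \<beta> (snd y)) * (?e y \<xi> * cnj (?e y \<eta>)) =
        (w (fst y) * cis ((p \<xi> - p \<eta>) * fst y)) * (\<beta> (snd y) * cis (snd y \<bullet> (\<xi> - \<eta>)))" for y
      by (simp add: cis_cnj cis_mult algebra_simps inner_diff_right)
    then show ?thesis
      by (simp only:) (intro integral_lborel_tensor integrable_mult_cis w \<beta>; measurable)
  qed
  then show "complex_of_real (LINT y|lborel. w (fst y) * \<beta> (snd y) * (norm (osc p g (fst y) (snd y)))\<^sup>2) =
       (LINT q|lborel. g (fst q) * cnj (g (snd q)) *
          ((LINT t|lborel. w t * cis ((p (fst q) - p (snd q)) * t)) *
           (LINT x|lborel. \<beta> x * cis (x \<bullet> (fst q - snd q)))))"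
    unfolding osc_def by (subst integral_quadratic_form [OF W g e e1]) simp
qed

text \<open>The counterpart at a fixed time, in which a point mass at \<open>t\<close> takes the
  place of \<open>w\<close>. Comparing the two forms gives \<open>osc_reproducing\<close>.\<close>

lemma
  fixes p :: "'a::euclidean_space \<Rightarrow> real"
  assumes \<beta>: "integrable lborel \<beta>" and g: "integrable lborel g"
    and p [measurable]: "p \<in> borel_measurable borel"
  shows integrable_osc_square_slice: "integrable lborel (\<lambda>x. \<beta> x * (norm (osc p g t x))\<^sup>2)"
    and integral_osc_square_slice:
      "complex_of_real (LINT x|lborel. \<beta> x * (norm (osc p g t x))\<^sup>2) =
       (LINT q|lborel. g (fst q) * cnj (g (snd q)) *
          (cis ((p (fst q) - p (snd q)) * t) * (LINT x|lborel. \<beta> x * cis (x \<bullet> (fst q - snd q)))))"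
proof -
  let ?e = "\<lambda>x \<xi>. cis (x \<bullet> \<xi> + t * p \<xi>)"
  have e: "(\<lambda>p. ?e (fst p) (snd p)) \<in> borel_measurable borel"
    unfolding borel_prod [symmetric] by measurable
  have e1: "norm (?e y \<xi>) = 1" for y \<xi>
    by simp
  show "integrable lborel (\<lambda>x. \<beta> x * (norm (osc p g t x))\<^sup>2)"
    unfolding osc_def by (rule integrable_quadratic_form [OF \<beta> g e e1])
  have "complex_of_real (\<beta> x) * (?e x \<xi> * cnj (?e x \<eta>)) =
      cis ((p \<xi> - p \<eta>) * t) * (\<beta> x * cis (x \<bullet> (\<xi> - \<eta>)))" for x \<xi> \<eta>
    by (simp add: cis_cnj cis_mult algebra_simps inner_diff_right)
  then have "(LINT x|lborel. complex_of_real (\<beta> x) * (?e x \<xi> * cnj (?e x \<eta>))) =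
      cis ((p \<xi> - p \<eta>) * t) * (LINT x|lborel. \<beta> x * cis (x \<bullet> (\<xi> - \<eta>)))" for \<xi> \<eta>
    by (simp only: integral_mult_right_zero)
  then show "complex_of_real (LINT x|lborel. \<beta> x * (norm (osc p g t x))\<^sup>2) =
       (LINT q|lborel. g (fst q) * cnj (g (snd q)) *
          (cis ((p (fst q) - p (snd q)) * t) * (LINT x|lborel. \<beta> x * cis (x \<bullet> (fst q - snd q)))))"
    unfolding osc_def by (subst integral_quadratic_form [OF \<beta> g e e1]) simp
qed

section \<open>A nonnegative weight with compactly supported Fourier transform\<close>

text \<open>The weight is a product of dilated Fejer kernels in the coordinates, centred at
  \<open>z\<close>. Up to a phase and a constant its transform is a product of triangles, supported
  in a cube.\<close>

lemma exists_bandlimited_bump: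
  fixes z :: "'a::euclidean_space"
  assumes r: "r > 0"
  shows "\<exists>\<beta> \<kappa>. \<kappa> > 0 \<and> integrable lborel \<beta> \<and> (\<forall>x. 0 \<le> \<beta> x) \<and> (\<forall>x\<in>ball z 1. \<kappa> \<le> \<beta> x) \<and>
     (\<forall>\<zeta>. r < norm \<zeta> \<longrightarrow> (LINT x|lborel. complex_of_real (\<beta> x) * cis (x \<bullet> \<zeta>)) = 0)"
proof -
  \<comment> \<open>The bound 1 keeps the arguments of \<open>fejer\<close> in [-1, 1] on the ball;
    the bound \<open>r / DIM('a)\<close> puts the cube of half-width \<open>\<rho>\<close> inside
    the ball of radius \<open>r\<close>.\<close>
  define \<rho> where "\<rho> = min 1 (r / DIM('a))"
  have \<rho>: "0 < \<rho>" "\<rho> \<le> 1" "\<rho> * DIM('a) \<le> r"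
    using r by (auto simp: \<rho>_def min_def field_simps)
  define \<beta> where "\<beta> x = (\<Prod>b\<in>Basis. fejer (\<rho> * ((x - z) \<bullet> b)))" for x :: 'a
  have fi: "integrable lborel (\<lambda>s. fejer (\<rho> * (s - z \<bullet> b)))" for b
    using \<rho> integrable_fejer lborel_integrable_real_affine [of fejer \<rho> "- \<rho> * (z \<bullet> b)"]
    by (simp add: algebra_simps)
  have int: "integrable lborel \<beta>"
    unfolding \<beta>_def [abs_def] inner_diff_left by (intro integrable_lborel_prod fi)
  have "(1 / 8) ^ DIM('a) \<le> \<beta> x" if "x \<in> ball z 1" for x
  proof -
    have "1 / 8 \<le> fejer (\<rho> * ((x - z) \<bullet> b))" if "b \<in> Basis" for b
    proof (rule fejer_lower)
      have "\<bar>(x - z) \<bullet> b\<bar> \<le> norm (x - z)"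
        using that by (rule Basis_le_norm)
      also have "\<dots> \<le> 1"
        using \<open>x \<in> ball z 1\<close> by (simp add: dist_norm norm_minus_commute)
      finally show "\<bar>\<rho> * ((x - z) \<bullet> b)\<bar> \<le> 1"
        using \<rho> by (simp add: abs_mult mult_le_one)
    qed
    then have "(\<Prod>b\<in>(Basis::'a set). 1 / 8) \<le> \<beta> x"
      unfolding \<beta>_def by (intro prod_mono) auto
    then show ?thesis
      by simp
  qed
  moreover have "(LINT x|lborel. complex_of_real (\<beta> x) * cis (x \<bullet> \<zeta>)) = 0" if "r < norm \<zeta>" for \<zeta>
  proof -
    \<comment> \<open>Otherwise the l1 norm of \<zeta>, and with it the norm, would be at most
      \<open>\<rho> * DIM('a) \<le> r\<close>.\<close>
    have "\<exists>b\<in>Basis. \<rho> < \<bar>\<zeta> \<bullet> b\<bar>"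
    proof (rule ccontr)
      assume "\<not> ?thesis"
      then have "(\<Sum>b\<in>Basis. \<bar>\<zeta> \<bullet> b\<bar>) \<le> (\<Sum>b\<in>(Basis::'a set). \<rho>)"
        by (intro sum_mono) (auto simp: not_less)
      then show False
        using norm_le_l1 [of \<zeta>] \<rho>(3) that by (simp add: mult.commute)
    qed
    then obtain b where b: "b \<in> Basis" "\<rho> < \<bar>\<zeta> \<bullet> b\<bar>"
      by blast
    let ?f = "\<lambda>b s. complex_of_real (fejer (\<rho> * (s - z \<bullet> b))) * cis (s * (\<zeta> \<bullet> b))"
    have "complex_of_real (\<beta> x) * cis (x \<bullet> \<zeta>) = (\<Prod>b\<in>Basis. ?f b (x \<bullet> b))" for x
    proof -
      have "cis (x \<bullet> \<zeta>) = (\<Prod>b\<in>Basis. cis ((x \<bullet> b) * (\<zeta> \<bullet> b)))"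
        by (subst euclidean_inner) (simp add: cis_conv_exp exp_sum sum_distrib_left)
      then show ?thesis
        by (simp add: \<beta>_def inner_diff_left prod.distrib)
    qed
    then have "(LINT x|lborel. complex_of_real (\<beta> x) * cis (x \<bullet> \<zeta>)) =
        (\<Prod>b\<in>Basis. LINT s|lborel. ?f b s)"
      by (simp only:) (intro integral_lborel_prod integrable_mult_cis fi; measurable)
    also have "\<dots> = 0"
    proof (rule prod_zero)
      \<comment> \<open>Recentring at the coordinate of \<open>z\<close> splits off a unimodular
        phase and leaves the triangle, which vanishes at this coordinate of \<zeta>.\<close>
      have "(LINT s|lborel. ?f b s) = (LINT s|lborel. ?f b (z \<bullet> b + 1 * s))"
        by (subst lborel_integral_real_affine [of 1 _ "z \<bullet> b"]) auto
      also have "\<dots> = (LINT s|lborel. cis ((z \<bullet> b) * (\<zeta> \<bullet> b)) *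
           (complex_of_real (fejer (\<rho> * s)) * cis ((\<zeta> \<bullet> b) * s)))"
        by (intro Bochner_Integration.integral_cong) (auto simp: cis_mult [symmetric] algebra_simps)
      also have "\<dots> = cis ((z \<bullet> b) * (\<zeta> \<bullet> b)) *
           complex_of_real (fejer_mass / \<rho> * max 0 (1 - \<bar>\<zeta> \<bullet> b\<bar> / \<rho>))"
        using has_bochner_integral_fejer_scaled [OF \<rho>(1), of "\<zeta> \<bullet> b"]
        by (simp only: integral_mult_right_zero has_bochner_integral_integral_eq)
      also have "max 0 (1 - \<bar>\<zeta> \<bullet> b\<bar> / \<rho>) = 0"
        using b \<rho>(1) by (simp add: max_def field_simps)
      finally show "\<exists>b\<in>Basis. (LINT s|lborel. ?f b s) = 0"
        using b by auto
    qed simp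
    finally show ?thesis .
  qed
  ultimately show ?thesis
    using int by (intro exI [of _ \<beta>] exI [of _ "(1 / 8) ^ DIM('a)"])
      (auto simp: \<beta>_def fejer_nonneg intro!: prod_nonneg)
qed

section \<open>Shells and the Schur test\<close>

lemma emeasure_lborel_translate:
  fixes S :: "'a::euclidean_space set"
  assumes [measurable]: "S \<in> sets borel"
  shows "emeasure lborel ((+) a ` S) = emeasure lborel S" "(+) a ` S \<in> sets borel"
proof -
  have eq: "(+) a ` S = (\<lambda>x. - a + x) -` S \<inter> space borel"
    by (force simp: image_iff algebra_simps)
  show "(+) a ` S \<in> sets borel"
    unfolding eq by measurable
  have "emeasure lborel S = emeasure (distr lborel borel ((+) (- a))) S"
    by (simp only: lborel_distr_plus)
  also have "\<dots> = emeasure lborel ((+) a ` S)"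
    unfolding eq by (subst emeasure_distr) auto
  finally show "emeasure lborel ((+) a ` S) = emeasure lborel S" ..
qed

text \<open>About \<open>1 / h\<close> disjoint translates of \<open>S\<close> fit into a ball of radius \<open>3\<close>.\<close>

lemma emeasure_le_of_disjoint_translates:
  fixes S :: "'a::euclidean_space set"
  assumes S [measurable]: "S \<in> sets borel" and sub: "S \<subseteq> cball x 1" and e: "norm e = 1" and h: "h > 0"
    and disj: "\<And>y t. y \<in> S \<Longrightarrow> h \<le> t \<Longrightarrow> y + t *\<^sub>R e \<notin> S"
  shows "emeasure lborel S \<le> ennreal (h * measure lborel (cball (0::'a) 3))"
proof -
  have "emeasure lborel (cball x 3) = emeasure lborel (cball (0::'a) 3)"
    using emeasure_lborel_translate(1) [of "cball 0 3" x] by simp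
  then have c: "emeasure lborel (cball x 3) = ennreal (measure lborel (cball (0::'a) 3))"
    using emeasure_lborel_cball_finite [of "0::'a" 3]
    by (simp add: emeasure_eq_ennreal_measure less_top)
  show ?thesis
  proof (cases "1 \<le> h")
    case True
    have "S \<subseteq> cball x 3"
      using sub by auto
    then have "emeasure lborel S \<le> emeasure lborel (cball x 3)"
      by (intro emeasure_mono) auto
    also have "\<dots> \<le> ennreal (h * measure lborel (cball (0::'a) 3))"
      unfolding c using True by (intro ennreal_leI mult_right_mono [of 1 h, simplified]) auto
    finally show ?thesis .
  next
    case False
    \<comment> \<open>As \<open>h < 1\<close>, this gives \<open>1 \<le> n * h \<le> 2\<close>. The
      upper bound keeps all translates of a subset of \<open>cball x 1\<close> in the ball of radius
      3; the lower bound converts the count \<open>n\<close> into the factor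
      \<open>h\<close>.\<close>
    define n where "n = nat \<lceil>1 / h\<rceil>"
    have n: "1 / h \<le> real n" "real n \<le> 1 / h + 1"
      using h unfolding n_def by (simp_all add: less_imp_le of_nat_ceiling)
    have nh: "real n * h \<le> 2" "1 \<le> real n * h"
      using n h False by (auto simp: field_simps)
    define T where "T k = (+) ((real k * h) *\<^sub>R e) ` S" for k
    have T_sets: "T k \<in> sets borel" for k
      unfolding T_def by (rule emeasure_lborel_translate) simp
    \<comment> \<open>A common point of two translates would give two points of \<open>S\<close>
      that differ by at least \<open>h\<close> along \<open>e\<close>.\<close>
    have "y \<notin> T k" if j: "y \<in> T j" "j < k" for j k y
    proof
      assume "y \<in> T k"
      then obtain u v where uv: "u \<in> S" "v \<in> S" "y = (real j * h) *\<^sub>R e + u" "y = (real k * h) *\<^sub>R e + v"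
        using j unfolding T_def by blast
      then have "u = v + ((real k - real j) * h) *\<^sub>R e"
        by (simp add: algebra_simps)
      moreover have "1 * h \<le> (real k - real j) * h"
        using that h by (intro mult_right_mono) auto
      ultimately show False
        using disj [of v] uv by auto
    qed
    then have "disjoint_family_on T {..<n}"
      by (auto simp: disjoint_family_on_def) (metis linorder_neqE_nat)
    then have "(\<Sum>k<n. emeasure lborel (T k)) = emeasure lborel (\<Union>k<n. T k)"
      by (intro sum_emeasure) (auto simp: T_sets)
    also have "\<dots> \<le> emeasure lborel (cball x 3)"
    proof (intro emeasure_mono subsetI)
      fix y assume "y \<in> (\<Union>k<n. T k)"
      then obtain k u where k: "k < n" "u \<in> S" "y = (real k * h) *\<^sub>R e + u"
        by (auto simp: T_def)
      have "norm (x - y) \<le> norm (x - u) + norm ((real k * h) *\<^sub>R e)"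
        using norm_triangle_ineq4 [of "x - u" "(real k * h) *\<^sub>R e"] by (simp add: k algebra_simps)
      also have "norm ((real k * h) *\<^sub>R e) \<le> real n * h"
        using k h e by (auto simp: abs_mult)
      finally show "y \<in> cball x 3"
        using nh k sub by (auto simp: dist_norm)
    qed simp
    finally have le: "of_nat n * emeasure lborel S \<le> ennreal (measure lborel (cball (0::'a) 3))"
      by (simp add: c T_def emeasure_lborel_translate)
    have fin: "emeasure lborel S = ennreal (measure lborel S)"
      using emeasure_mono [OF sub, of lborel] emeasure_lborel_cball_finite [of x 1]
      by (intro emeasure_eq_ennreal_measure) (auto simp: less_top)
    have "real n * measure lborel S \<le> measure lborel (cball (0::'a) 3)"
      using le by (simp add: fin ennreal_of_nat_eq_real_of_nat ennreal_mult [symmetric])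
    then have "h * (real n * measure lborel S) \<le> h * measure lborel (cball (0::'a) 3)"
      using h by (intro mult_left_mono) auto
    moreover have "1 * measure lborel S \<le> (real n * h) * measure lborel S"
      using nh by (intro mult_right_mono) auto
    ultimately have "measure lborel S \<le> h * measure lborel (cball (0::'a) 3)"
      by (simp add: mult_ac)
    then show ?thesis
      unfolding fin by (rule ennreal_leI)
  qed
qed

section \<open>Increments of the dispersion relation and the measure of thin shells\<close>

text \<open>Monotonicity of the power \<open>\<gamma> - 1\<close> suffices: after expansion the
  claim compares \<open>v * u powr (\<gamma> - 1)\<close> with \<open>v powr \<gamma>\<close>. The
  bound makes shells thin.\<close>

lemma powr_diff_ge:
  fixes u v :: real
  assumes "\<gamma> > 1" "0 < u" "u \<le> v"
  shows "u powr (\<gamma> - 1) * (v - u) \<le> v powr \<gamma> - u powr \<gamma>"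
proof -
  have "v * u powr (\<gamma> - 1) \<le> v * v powr (\<gamma> - 1)"
    using assms by (intro mult_left_mono powr_mono2) auto
  moreover have "v * v powr (\<gamma> - 1) = v powr \<gamma>" "u * u powr (\<gamma> - 1) = u powr \<gamma>"
    using assms by (simp_all add: powr_mult_base)
  ultimately show ?thesis
    by (simp add: algebra_simps)
qed

text \<open>The mean value theorem with the derivative bounded at \<open>M\<close>. It limits the
  time frequencies of a frequency-localised piece.\<close>

lemma powr_diff_le:
  fixes u v :: real
  assumes "\<gamma> > 1" "0 < u" "0 < v" "u \<le> M" "v \<le> M"
  shows "\<bar>v powr \<gamma> - u powr \<gamma>\<bar> \<le> \<gamma> * M powr (\<gamma> - 1) * \<bar>v - u\<bar>"
proof -
  have *: "v powr \<gamma> - u powr \<gamma> \<le> \<gamma> * M powr (\<gamma> - 1) * (v - u)" "u powr \<gamma> \<le> v powr \<gamma>"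
    if "0 < u" "u \<le> v" "v \<le> M" for u v
  proof -
    show "u powr \<gamma> \<le> v powr \<gamma>"
      using that assms by (intro powr_mono2) auto
    show "v powr \<gamma> - u powr \<gamma> \<le> \<gamma> * M powr (\<gamma> - 1) * (v - u)"
    proof (cases "u = v")
      case False
      then have "\<exists>x>u. x < v \<and> v powr \<gamma> - u powr \<gamma> = (v - u) * (\<gamma> * x powr (\<gamma> - 1))"
        using that by (intro MVT2) (auto intro!: has_real_derivative_powr)
      then obtain x where x: "u < x" "x < v" "v powr \<gamma> - u powr \<gamma> = (v - u) * (\<gamma> * x powr (\<gamma> - 1))"
        by blast
      have "(v - u) * (\<gamma> * x powr (\<gamma> - 1)) \<le> (v - u) * (\<gamma> * M powr (\<gamma> - 1))"
        using x that assms by (intro mult_left_mono powr_mono2) auto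
      then show ?thesis
        using x by (simp add: mult_ac)
    qed simp
  qed
  show ?thesis
    using *[of u v] *[of v u] assms by (cases "u \<le> v") (auto simp: abs_if algebra_simps)
qed

lemma power2_norm_add_scaleR:
  fixes a b :: "'a::real_inner"
  shows "(norm (a + t *\<^sub>R b))\<^sup>2 = (norm a)\<^sup>2 + 2 * t * (a \<bullet> b) + t\<^sup>2 * (norm b)\<^sup>2"
  unfolding power2_norm_eq_inner
  by (simp add: inner_add_left inner_add_right inner_commute [of b a] power2_eq_square [of t] algebra_simps)

text \<open>A shift by \<open>t\<close> in the direction of \<xi> raises the norm of a nearby point
  by more than \<open>t / 2\<close>. If \<open>t\<close> is at least the step fixed here, the
  shifted point leaves the shell, so the packing bound
  \<open>emeasure_le_of_disjoint_translates\<close> applies.\<close>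

lemma emeasure_shell_le:
  fixes \<xi> :: "'a::euclidean_space"
  assumes \<gamma>: "\<gamma> > 1" and \<epsilon>: "\<epsilon> > 0" and \<xi>: "1 / 2 \<le> norm \<xi>"
  shows "emeasure lborel {\<eta>. norm (\<xi> - \<eta>) \<le> 1 / 16 \<and> \<bar>norm \<xi> powr \<gamma> - norm \<eta> powr \<gamma>\<bar> \<le> \<epsilon>}
     \<le> ennreal (5 * \<epsilon> * (norm \<xi> / 2) powr (1 - \<gamma>) * measure lborel (cball (0::'a) 3))"
    (is "emeasure lborel ?S \<le> _")
proof -
  have "\<xi> \<noteq> 0"
    using \<xi> by auto
  show ?thesis
  proof (rule emeasure_le_of_disjoint_translates [where x = \<xi> and e = "\<xi> /\<^sub>R norm \<xi>"])
    show "?S \<in> sets borel"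
      by measurable
    show "?S \<subseteq> cball \<xi> 1"
      by (auto simp: dist_norm)
    show "norm (\<xi> /\<^sub>R norm \<xi>) = 1"
      using \<open>\<xi> \<noteq> 0\<close> by simp
    show pos: "0 < 5 * \<epsilon> * (norm \<xi> / 2) powr (1 - \<gamma>)"
      using \<epsilon> \<open>\<xi> \<noteq> 0\<close> by (intro mult_pos_pos) auto
    fix \<eta> t
    assume \<eta>: "\<eta> \<in> ?S" and t: "5 * \<epsilon> * (norm \<xi> / 2) powr (1 - \<gamma>) \<le> t"
    let ?e = "\<xi> /\<^sub>R norm \<xi>"
    define \<zeta> where "\<zeta> = \<eta> + t *\<^sub>R ?e"
    have t0: "0 < t"
      using pos t by linarith
    show "\<eta> + t *\<^sub>R ?e \<notin> ?S"
    proof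
      assume "\<eta> + t *\<^sub>R ?e \<in> ?S"
      then have \<zeta>: "norm (\<xi> - \<zeta>) \<le> 1 / 16" "\<bar>norm \<xi> powr \<gamma> - norm \<zeta> powr \<gamma>\<bar> \<le> \<epsilon>"
        by (auto simp: \<zeta>_def)
      have e1: "norm ?e = 1"
        using \<open>\<xi> \<noteq> 0\<close> by simp
      have "\<xi> \<bullet> ?e = norm \<xi>"
        using \<open>\<xi> \<noteq> 0\<close> by (simp add: dot_square_norm power2_eq_square)
      moreover have "\<bar>(\<xi> - \<eta>) \<bullet> ?e\<bar> \<le> 1 / 16"
        using Cauchy_Schwarz_ineq2 [of "\<xi> - \<eta>" ?e] \<eta> by (simp only: e1) simp
      \<comment> \<open>As \<xi> has norm at least 1/2, the deviation 1/16 is at most an eighth of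
        it.\<close>
      ultimately have ip: "7 / 8 * norm \<xi> \<le> \<eta> \<bullet> ?e"
        using \<xi> unfolding inner_diff_left by linarith
      have n: "7 / 8 * norm \<xi> \<le> norm \<eta>" "norm \<eta> \<le> 9 / 8 * norm \<xi>" "norm \<zeta> \<le> 9 / 8 * norm \<xi>"
        using \<eta> \<zeta> \<xi> norm_triangle_ineq2 [of \<xi> \<eta>] norm_triangle_ineq2 [of \<eta> \<xi>] norm_triangle_ineq2 [of \<zeta> \<xi>]
        by (auto simp: norm_minus_commute)
      have "(norm \<zeta>)\<^sup>2 = (norm \<eta>)\<^sup>2 + 2 * t * (\<eta> \<bullet> ?e) + t\<^sup>2 * (norm ?e)\<^sup>2"
        unfolding \<zeta>_def by (rule power2_norm_add_scaleR)
      then have "(norm \<zeta>)\<^sup>2 \<ge> (norm \<eta>)\<^sup>2 + 2 * t * (\<eta> \<bullet> ?e)"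
        by simp
      moreover have "2 * t * (7 / 8 * norm \<xi>) \<le> 2 * t * (\<eta> \<bullet> ?e)"
        using ip t0 by (intro mult_left_mono) auto
      ultimately have sq: "7 / 4 * t * norm \<xi> \<le> (norm \<zeta> - norm \<eta>) * (norm \<zeta> + norm \<eta>)"
        by (simp add: algebra_simps power2_eq_square)
      have "0 < 7 / 4 * t * norm \<xi>"
        using t0 \<open>\<xi> \<noteq> 0\<close> by simp
      then have less: "norm \<eta> < norm \<zeta>"
        using sq by (smt (verit, ccfv_threshold) mult_nonpos_nonneg norm_ge_zero)
      have "(norm \<zeta> - norm \<eta>) * (norm \<zeta> + norm \<eta>) \<le> (norm \<zeta> - norm \<eta>) * (9 / 4 * norm \<xi>)"
        using less n by (intro mult_left_mono) auto
      with sq have "7 / 4 * t * norm \<xi> \<le> (norm \<zeta> - norm \<eta>) * (9 / 4) * norm \<xi>"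
        by (simp add: mult_ac)
      \<comment> \<open>Dividing by the sum of the norms leaves \<open>7 / 9 * t\<close>, which
        exceeds \<open>t / 2\<close>.\<close>
      then have "t / 2 < norm \<zeta> - norm \<eta>"
        using \<xi> t0 by (subst (asm) mult_le_cancel_right) auto
      \<comment> \<open>The factor 5 in the step makes the increase of the power at least
        \<open>5 / 2 * \<epsilon>\<close>, whereas two points of the shell differ by at most
        \<open>2 * \<epsilon>\<close>.\<close>
      have "5 / 2 * \<epsilon> = (norm \<xi> / 2) powr (\<gamma> - 1) * (5 * \<epsilon> * (norm \<xi> / 2) powr (1 - \<gamma>) / 2)"
        using \<open>\<xi> \<noteq> 0\<close> by (simp add: powr_diff field_simps)
      also have "\<dots> \<le> norm \<eta> powr (\<gamma> - 1) * (norm \<zeta> - norm \<eta>)"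
        using t n \<open>t / 2 < norm \<zeta> - norm \<eta>\<close> \<xi> \<gamma> \<epsilon> by (intro mult_mono powr_mono2) auto
      also have "\<dots> \<le> norm \<zeta> powr \<gamma> - norm \<eta> powr \<gamma>"
        using \<gamma> less n \<xi> by (intro powr_diff_ge) auto
      also have "\<dots> \<le> 2 * \<epsilon>"
        using \<zeta> \<eta> by auto
      finally show False
        using \<epsilon> by auto
    qed
  qed
qed

lemma nn_integral_lborel_pair:
  fixes f :: "'a::euclidean_space \<times> 'b::euclidean_space \<Rightarrow> ennreal"
  assumes [measurable]: "f \<in> borel_measurable borel"
  shows "(\<integral>\<^sup>+p. f p \<partial>lborel) = (\<integral>\<^sup>+x. \<integral>\<^sup>+y. f (x, y) \<partial>lborel \<partial>lborel)"
    and "(\<integral>\<^sup>+p. f p \<partial>lborel) = (\<integral>\<^sup>+y. \<integral>\<^sup>+x. f (x, y) \<partial>lborel \<partial>lborel)"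
proof -
  have f: "f \<in> borel_measurable (lborel \<Otimes>\<^sub>M lborel)"
    using assms by (simp add: lborel_prod)
  show "(\<integral>\<^sup>+p. f p \<partial>lborel) = (\<integral>\<^sup>+x. \<integral>\<^sup>+y. f (x, y) \<partial>lborel \<partial>lborel)"
    using lborel.nn_integral_fst [OF f] by (simp add: lborel_prod)
  show "(\<integral>\<^sup>+p. f p \<partial>lborel) = (\<integral>\<^sup>+y. \<integral>\<^sup>+x. f (x, y) \<partial>lborel \<partial>lborel)"
    using lborel_pair.nn_integral_snd [OF f] by (simp add: lborel_prod split_def)
qed

section \<open>Schur's test\<close>

text \<open>The product of the two values of \<open>g\<close> is dominated by the sum of their
  squares; by symmetry both terms reduce to the same row integral, whence the factor 2. The row
  bound is asked for on the support of \<open>g\<close>, where the frequency localisation is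
  available.\<close>

lemma schur_test:
  fixes g :: "'a::euclidean_space \<Rightarrow> complex" and \<kappa> :: "'a \<times> 'a \<Rightarrow> ennreal"
  assumes g [measurable]: "g \<in> borel_measurable borel" and \<kappa> [measurable]: "\<kappa> \<in> borel_measurable borel"
    and sym: "\<And>\<xi> \<eta>. \<kappa> (\<xi>, \<eta>) = \<kappa> (\<eta>, \<xi>)"
    and bound: "\<And>\<xi>. g \<xi> \<noteq> 0 \<Longrightarrow> (\<integral>\<^sup>+\<eta>. \<kappa> (\<xi>, \<eta>) \<partial>lborel) \<le> S"
  shows "(\<integral>\<^sup>+q. ennreal (norm (g (fst q) * cnj (g (snd q)))) * \<kappa> q \<partial>lborel)
     \<le> 2 * S * (\<integral>\<^sup>+\<xi>. ennreal ((norm (g \<xi>))\<^sup>2) \<partial>lborel)"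
proof -
  let ?G = "\<lambda>\<xi>. ennreal ((norm (g \<xi>))\<^sup>2)"
  have \<kappa>' [measurable]: "\<kappa> \<in> borel_measurable (borel \<Otimes>\<^sub>M borel)"
    by (simp add: borel_prod)
  have "ennreal (norm (g \<xi> * cnj (g \<eta>))) \<le> ?G \<xi> + ?G \<eta>" for \<xi> \<eta>
  proof -
    have "norm (g \<xi>) * norm (g \<eta>) \<le> (norm (g \<xi>))\<^sup>2 + (norm (g \<eta>))\<^sup>2"
      using sum_squares_bound [of "norm (g \<xi>)" "norm (g \<eta>)"]
        mult_nonneg_nonneg [OF norm_ge_zero [of "g \<xi>"] norm_ge_zero [of "g \<eta>"]]
      by linarith
    then show ?thesis
      by (simp add: norm_mult ennreal_leI flip: ennreal_plus)
  qed
  then have "(\<integral>\<^sup>+q. ennreal (norm (g (fst q) * cnj (g (snd q)))) * \<kappa> q \<partial>lborel)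
      \<le> (\<integral>\<^sup>+q. (?G (fst q) + ?G (snd q)) * \<kappa> q \<partial>lborel)"
    by (intro nn_integral_mono mult_right_mono) auto
  also have "\<dots> = (\<integral>\<^sup>+q. ?G (fst q) * \<kappa> q \<partial>lborel) + (\<integral>\<^sup>+q. ?G (snd q) * \<kappa> q \<partial>lborel)"
    unfolding distrib_right
    by (rule nn_integral_add) (simp_all add: borel_prod [symmetric])
  also have "(\<integral>\<^sup>+q. ?G (fst q) * \<kappa> q \<partial>lborel) = (\<integral>\<^sup>+\<xi>. ?G \<xi> * (\<integral>\<^sup>+\<eta>. \<kappa> (\<xi>, \<eta>) \<partial>lborel) \<partial>lborel)"
    by (subst nn_integral_lborel_pair(1)) (simp_all add: borel_prod [symmetric] nn_integral_cmult)
  also have "(\<integral>\<^sup>+q. ?G (snd q) * \<kappa> q \<partial>lborel) = (\<integral>\<^sup>+\<xi>. ?G \<xi> * (\<integral>\<^sup>+\<eta>. \<kappa> (\<xi>, \<eta>) \<partial>lborel) \<partial>lborel)"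
    by (subst nn_integral_lborel_pair(2)) (simp_all add: borel_prod [symmetric] nn_integral_cmult sym)
  also have "(\<integral>\<^sup>+\<xi>. ?G \<xi> * (\<integral>\<^sup>+\<eta>. \<kappa> (\<xi>, \<eta>) \<partial>lborel) \<partial>lborel) \<le> (\<integral>\<^sup>+\<xi>. S * ?G \<xi> \<partial>lborel)"
  proof (intro nn_integral_mono)
    fix \<xi>
    show "?G \<xi> * (\<integral>\<^sup>+\<eta>. \<kappa> (\<xi>, \<eta>) \<partial>lborel) \<le> S * ?G \<xi>"
      using bound [of \<xi>] by (cases "g \<xi> = 0") (auto simp: mult.commute [of S] intro!: mult_left_mono)
  qed
  also have "(\<integral>\<^sup>+\<xi>. S * ?G \<xi> \<partial>lborel) = S * (\<integral>\<^sup>+\<xi>. ?G \<xi> \<partial>lborel)"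
    by (rule nn_integral_cmult) simp
  finally show ?thesis
    by (simp add: mult_2 distrib_right add_mono)
qed

section \<open>Local smoothing\<close>

lemma borel_measurable_osc [measurable]:
  fixes p :: "'a::euclidean_space \<Rightarrow> real"
  assumes [measurable]: "p \<in> borel_measurable borel" "g \<in> borel_measurable borel"
  shows "(\<lambda>y. osc p g (fst y) (snd y)) \<in> borel_measurable (borel \<Otimes>\<^sub>M borel)"
  unfolding osc_def by measurable

text \<open>For a function that is not integrable, the integral is 0 by convention, so the bound
  persists.\<close>

lemma integral_norm_bound_ennreal':
  fixes f :: "_ \<Rightarrow> 'b::{banach, second_countable_topology}"
  shows "ennreal (norm (integral\<^sup>L M f)) \<le> (\<integral>\<^sup>+x. ennreal (norm (f x)) \<partial>M)"
  by (cases "integrable M f") (simp_all add: integral_norm_bound_ennreal not_integrable_integral_eq)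

text \<open>With the time weight \<open>fejer (\<epsilon> * t)\<close> the kernel of the quadratic
  form has height of order \<open>1 / \<epsilon>\<close> and lives on shells of measure of order
  \<open>\<epsilon> * \<Lambda> powr (1 - \<gamma>)\<close>. Schur's test then gives a bound
  independent of \<epsilon>, and \<epsilon> tends to 0.\<close>

lemma local_smoothing:
  fixes \<beta> :: "'a::euclidean_space \<Rightarrow> real"
  assumes \<gamma>: "\<gamma> > 1" and \<beta>: "integrable lborel \<beta>" "\<And>x. 0 \<le> \<beta> x"
    and band: "\<And>\<zeta>. 1 / 16 < norm \<zeta> \<Longrightarrow> (LINT x|lborel. complex_of_real (\<beta> x) * cis (x \<bullet> \<zeta>)) = 0"
  shows "\<exists>C\<ge>0. \<forall>\<Lambda>\<ge>2. \<forall>g. integrable lborel g \<longrightarrow> (\<forall>\<xi>. g \<xi> \<noteq> 0 \<longrightarrow> \<Lambda> / 4 \<le> norm \<xi>) \<longrightarrow>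
     (\<integral>\<^sup>+y. ennreal (\<beta> (snd y) * (norm (osc (\<lambda>\<xi>. norm \<xi> powr \<gamma>) g (fst y) (snd y)))\<^sup>2) \<partial>lborel)
     \<le> ennreal (C * \<Lambda> powr (1 - \<gamma>)) * (\<integral>\<^sup>+\<xi>. ennreal ((norm (g \<xi>))\<^sup>2) \<partial>lborel)"
proof -
  define A where "A = (LINT x|lborel. \<beta> x)"
  define V where "V = measure lborel (cball (0::'a) 3)"
  have A: "0 \<le> A" "norm (LINT x|lborel. complex_of_real (\<beta> x) * cis (x \<bullet> \<zeta>)) \<le> A" for \<zeta>
  proof -
    show "0 \<le> A"
      using \<beta> by (simp add: A_def)
    have "norm (LINT x|lborel. complex_of_real (\<beta> x) * cis (x \<bullet> \<zeta>)) \<le>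
        (LINT x|lborel. norm (complex_of_real (\<beta> x) * cis (x \<bullet> \<zeta>)))"
      by (rule integral_norm_bound)
    then show "norm (LINT x|lborel. complex_of_real (\<beta> x) * cis (x \<bullet> \<zeta>)) \<le> A"
      using \<beta> by (simp add: A_def norm_mult)
  qed
  have [measurable]: "\<beta> \<in> borel_measurable borel"
    using \<beta> by (auto dest: borel_measurable_integrable)
  let ?p = "\<lambda>\<xi>::'a. norm \<xi> powr \<gamma>"
  \<comment> \<open>The 16 is 8 from \<open>fejer_lower\<close> times 2 from Schur's test;
    \<open>5 * V\<close> comes from the shell bound, and 1/8 from half the lower frequency bound
    \<open>\<Lambda> / 4\<close>.\<close>
  define C where "C = 16 * (A * fejer_mass * 5 * V * (1 / 8) powr (1 - \<gamma>))"
  have C0: "0 \<le> C"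
    using A fejer_mass_pos by (auto simp: C_def V_def intro!: mult_nonneg_nonneg)
  have main: "(\<integral>\<^sup>+y. ennreal (\<beta> (snd y) * (norm (osc ?p g (fst y) (snd y)))\<^sup>2) \<partial>lborel)
     \<le> ennreal (C * \<Lambda> powr (1 - \<gamma>)) * (\<integral>\<^sup>+\<xi>. ennreal ((norm (g \<xi>))\<^sup>2) \<partial>lborel)"
    if \<Lambda>: "\<Lambda> \<ge> 2" and g: "integrable lborel g" and supp: "\<And>\<xi>. g \<xi> \<noteq> 0 \<Longrightarrow> \<Lambda> / 4 \<le> norm \<xi>"
    for \<Lambda> and g :: "'a \<Rightarrow> complex"
  proof -
    have [measurable]: "g \<in> borel_measurable borel"
      using g by (auto dest: borel_measurable_integrable)
    let ?f = "\<lambda>y. \<beta> (snd y) * (norm (osc ?p g (fst y) (snd y)))\<^sup>2"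
    let ?G = "\<integral>\<^sup>+\<xi>. ennreal ((norm (g \<xi>))\<^sup>2) \<partial>lborel"
    let ?B = "ennreal (C * \<Lambda> powr (1 - \<gamma>)) * ?G"
    have f_meas: "?f \<in> borel_measurable (borel \<Otimes>\<^sub>M borel)"
      by measurable
    have f_meas' [measurable]: "?f \<in> borel_measurable borel"
      using f_meas by (simp only: borel_prod)
    have loc: "(\<integral>\<^sup>+y. ennreal (fejer (\<epsilon> * fst y) * ?f y) \<partial>lborel)
        \<le> ennreal (A * fejer_mass * 5 * V * (1 / 8) powr (1 - \<gamma>) * \<Lambda> powr (1 - \<gamma>)) * (2 * ?G)"
      if \<epsilon>: "\<epsilon> > 0" for \<epsilon>
    proof -
      \<comment> \<open>The first condition is the support of the transform of
        \<open>\<beta>\<close>, the second that of the transform of the time weight. The kernel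
        vanishes off this set.\<close>
      define D where "D = {q::'a\<times>'a. norm (fst q - snd q) \<le> 1 / 16 \<and> \<bar>?p (fst q) - ?p (snd q)\<bar> \<le> \<epsilon>}"
      have D [measurable]: "D \<in> sets borel"
      proof -
        have "Measurable.pred (borel \<Otimes>\<^sub>M borel)
            (\<lambda>q::'a\<times>'a. norm (fst q - snd q) \<le> 1 / 16 \<and> \<bar>?p (fst q) - ?p (snd q)\<bar> \<le> \<epsilon>)"
          by measurable
        then show ?thesis
          by (simp add: D_def pred_def space_pair_measure borel_prod)
      qed
      define \<kappa> where "\<kappa> q = ennreal (A * (fejer_mass / \<epsilon>)) * indicator D q" for q
      let ?T = "\<lambda>t. LINT s|lborel. complex_of_real (fejer (\<epsilon> * s)) * cis (t * s)"
      let ?X = "\<lambda>\<zeta>. LINT x|lborel. complex_of_real (\<beta> x) * cis (x \<bullet> \<zeta>)"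
      have wint: "integrable lborel (\<lambda>s. fejer (\<epsilon> * s))"
        using \<epsilon> integrable_fejer lborel_integrable_real_affine [of fejer \<epsilon> 0] by simp
      have T: "?T t = complex_of_real (fejer_mass / \<epsilon> * max 0 (1 - \<bar>t\<bar> / \<epsilon>))" for t
        by (rule has_bochner_integral_integral_eq [OF has_bochner_integral_fejer_scaled [OF \<epsilon>]])
      have k: "ennreal (norm (?T (?p (fst q) - ?p (snd q)) * ?X (fst q - snd q))) \<le> \<kappa> q" for q
      proof (cases "q \<in> D")
        case True
        have "norm (?T (?p (fst q) - ?p (snd q))) \<le> fejer_mass / \<epsilon>"
          unfolding T norm_of_real using \<epsilon> fejer_mass_pos
          by (simp add: abs_mult mult_left_le divide_right_mono max_def)
        then have "norm (?T (?p (fst q) - ?p (snd q)) * ?X (fst q - snd q)) \<le> fejer_mass / \<epsilon> * A"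
          unfolding norm_mult using A \<epsilon> fejer_mass_pos by (intro mult_mono) auto
        then show ?thesis
          using True by (simp add: \<kappa>_def ennreal_leI mult.commute)
      next
        case False
        then have "norm (fst q - snd q) > 1 / 16 \<or> \<bar>?p (fst q) - ?p (snd q)\<bar> > \<epsilon>"
          by (auto simp: D_def)
        then have "?X (fst q - snd q) = 0 \<or> ?T (?p (fst q) - ?p (snd q)) = 0"
        proof (elim disj_forward)
          assume "norm (fst q - snd q) > 1 / 16"
          then show "?X (fst q - snd q) = 0"
            by (rule band)
        next
          assume "\<bar>?p (fst q) - ?p (snd q)\<bar> > \<epsilon>"
          then have "max 0 (1 - \<bar>?p (fst q) - ?p (snd q)\<bar> / \<epsilon>) = 0"
            using \<epsilon> by (simp add: max_def field_simps)
          then show "?T (?p (fst q) - ?p (snd q)) = 0"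
            unfolding T by simp
        qed
        then show ?thesis
          by auto
      qed
      have p: "?p \<in> borel_measurable borel"
        by measurable
      have fnn: "0 \<le> fejer (\<epsilon> * fst y) * \<beta> (snd y) * (norm (osc ?p g (fst y) (snd y)))\<^sup>2" for y
        using \<beta> fejer_nonneg by (intro mult_nonneg_nonneg) auto
      have "(\<integral>\<^sup>+y. ennreal (fejer (\<epsilon> * fst y) * ?f y) \<partial>lborel)
        = ennreal (LINT y|lborel. fejer (\<epsilon> * fst y) * \<beta> (snd y) * (norm (osc ?p g (fst y) (snd y)))\<^sup>2)"
        unfolding mult.assoc [symmetric]
        by (intro nn_integral_eq_integral integrable_osc_square [OF wint \<beta>(1) g p] AE_I2 fnn)
      also have "(LINT y|lborel. fejer (\<epsilon> * fst y) * \<beta> (snd y) * (norm (osc ?p g (fst y) (snd y)))\<^sup>2)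
          \<le> norm (complex_of_real (LINT y|lborel. fejer (\<epsilon> * fst y) * \<beta> (snd y) * (norm (osc ?p g (fst y) (snd y)))\<^sup>2))"
        by simp
      also have "ennreal \<dots> \<le> (\<integral>\<^sup>+q. ennreal (norm (g (fst q) * cnj (g (snd q)) *
           (?T (?p (fst q) - ?p (snd q)) * ?X (fst q - snd q)))) \<partial>lborel)"
        unfolding integral_osc_square [OF wint \<beta>(1) g p] by (rule integral_norm_bound_ennreal')
      also have "\<dots> \<le> (\<integral>\<^sup>+q. ennreal (norm (g (fst q) * cnj (g (snd q)))) * \<kappa> q \<partial>lborel)"
        unfolding norm_mult [of "g _ * _"] using k
        by (intro nn_integral_mono) (auto simp: ennreal_mult' intro!: mult_left_mono)
      also have "\<dots> \<le> 2 * ennreal (A * fejer_mass * 5 * V * (1 / 8) powr (1 - \<gamma>) * \<Lambda> powr (1 - \<gamma>)) * ?G"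
      proof (rule schur_test)
        show "\<kappa> \<in> borel_measurable borel"
          unfolding \<kappa>_def [abs_def] by measurable
        show "\<kappa> (\<xi>, \<eta>) = \<kappa> (\<eta>, \<xi>)" for \<xi> \<eta>
          by (auto simp: \<kappa>_def D_def indicator_def norm_minus_commute abs_minus_commute)
        fix \<xi> assume "g \<xi> \<noteq> 0"
        then have \<xi>: "\<Lambda> / 4 \<le> norm \<xi>"
          by (rule supp)
        let ?S = "{\<eta>. norm (\<xi> - \<eta>) \<le> 1 / 16 \<and> \<bar>?p \<xi> - ?p \<eta>\<bar> \<le> \<epsilon>}"
        have "(\<integral>\<^sup>+\<eta>. \<kappa> (\<xi>, \<eta>) \<partial>lborel) = (\<integral>\<^sup>+\<eta>. ennreal (A * (fejer_mass / \<epsilon>)) * indicator ?S \<eta> \<partial>lborel)"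
          by (intro nn_integral_cong) (auto simp: \<kappa>_def D_def indicator_def)
        also have "\<dots> = ennreal (A * (fejer_mass / \<epsilon>)) * emeasure lborel ?S"
          by (rule nn_integral_cmult_indicator) measurable
        \<comment> \<open>Here \<open>\<Lambda> \<ge> 2\<close> provides the lower bound 1/2 on the
          norm of \<xi>, and the two powers of \<epsilon> cancel.\<close>
        also have "\<dots> \<le> ennreal (A * (fejer_mass / \<epsilon>)) * ennreal (5 * \<epsilon> * (norm \<xi> / 2) powr (1 - \<gamma>) * V)"
          unfolding V_def using \<xi> \<Lambda> by (intro mult_left_mono emeasure_shell_le \<gamma> \<epsilon>) auto
        also have "\<dots> = ennreal (A * fejer_mass * 5 * V * (norm \<xi> / 2) powr (1 - \<gamma>))"
          using A \<epsilon> fejer_mass_pos by (subst ennreal_mult' [symmetric]) (auto simp: V_def)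
        also have "\<dots> \<le> ennreal (A * fejer_mass * 5 * V * ((1 / 8) powr (1 - \<gamma>) * \<Lambda> powr (1 - \<gamma>)))"
        proof (intro ennreal_leI mult_left_mono)
          have "(norm \<xi> / 2) powr (1 - \<gamma>) \<le> (1 / 8 * \<Lambda>) powr (1 - \<gamma>)"
            using \<xi> \<Lambda> \<gamma> by (intro powr_mono2') auto
          then show "(norm \<xi> / 2) powr (1 - \<gamma>) \<le> (1 / 8) powr (1 - \<gamma>) * \<Lambda> powr (1 - \<gamma>)"
            using \<Lambda> by (subst (asm) powr_mult) auto
        qed (use A fejer_mass_pos in \<open>auto simp: V_def\<close>)
        finally show "(\<integral>\<^sup>+\<eta>. \<kappa> (\<xi>, \<eta>) \<partial>lborel)
            \<le> ennreal (A * fejer_mass * 5 * V * (1 / 8) powr (1 - \<gamma>) * \<Lambda> powr (1 - \<gamma>))"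
          by (simp add: mult.assoc)
      qed simp
      finally show ?thesis
        by (simp add: mult_ac ennreal_leI)
    qed
    \<comment> \<open>With \<open>\<epsilon> = 1 / n\<close> the weight is at least 1/8 on the times
      up to \<open>n\<close>, so 8 times the weighted integral dominates the truncated one.\<close>
    have bound: "(\<integral>\<^sup>+y. ennreal (?f y) * indicator {y. \<bar>fst y\<bar> \<le> real n} y \<partial>lborel) \<le> ?B" if n: "n > 0" for n
    proof -
      have "(\<integral>\<^sup>+y. ennreal (?f y) * indicator {y. \<bar>fst y\<bar> \<le> real n} y \<partial>lborel)
         \<le> (\<integral>\<^sup>+y. 8 * ennreal (fejer (1 / real n * fst y) * ?f y) \<partial>lborel)"
      proof (intro nn_integral_mono)
        fix y :: "real \<times> 'a"
        have "ennreal (?f y) \<le> 8 * ennreal (fejer (1 / real n * fst y) * ?f y)" if "\<bar>fst y\<bar> \<le> real n"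
        proof -
          have "1 / 8 \<le> fejer (1 / real n * fst y)"
            using that n by (intro fejer_lower) (auto simp: abs_mult)
          then have "1 / 8 * ?f y \<le> fejer (1 / real n * fst y) * ?f y"
            using \<beta> by (intro mult_right_mono) auto
          then have "?f y \<le> 8 * (fejer (1 / real n * fst y) * ?f y)"
            by simp
          then have "ennreal (?f y) \<le> ennreal (8 * (fejer (1 / real n * fst y) * ?f y))"
            by (rule ennreal_leI)
          also have "\<dots> = 8 * ennreal (fejer (1 / real n * fst y) * ?f y)"
            by (subst ennreal_mult') auto
          finally show ?thesis .
        qed
        then show "ennreal (?f y) * indicator {y. \<bar>fst y\<bar> \<le> real n} y \<le> 8 * ennreal (fejer (1 / real n * fst y) * ?f y)"
          by (simp add: indicator_def)
      qed
      also have "\<dots> = 8 * (\<integral>\<^sup>+y. ennreal (fejer (1 / real n * fst y) * ?f y) \<partial>lborel)"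
        using f_meas by (intro nn_integral_cmult) (simp add: borel_prod [symmetric])
      also have "\<dots> \<le> 8 * (ennreal (A * fejer_mass * 5 * V * (1 / 8) powr (1 - \<gamma>) * \<Lambda> powr (1 - \<gamma>)) * (2 * ?G))"
        using n by (intro mult_left_mono loc) auto
      also have "\<dots> = ennreal 16 * ennreal (A * fejer_mass * 5 * V * (1 / 8) powr (1 - \<gamma>) * \<Lambda> powr (1 - \<gamma>)) * ?G"
        by (simp add: mult_ac)
      also have "\<dots> = ?B"
        by (subst ennreal_mult' [symmetric]) (simp_all add: C_def mult_ac)
      finally show ?thesis .
    qed
    have "(\<integral>\<^sup>+y. ennreal (?f y) \<partial>lborel)
       = (\<integral>\<^sup>+y. (SUP n. ennreal (?f y) * indicator {y. \<bar>fst y\<bar> \<le> real n} y) \<partial>lborel)"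
    proof (intro nn_integral_cong antisym)
      fix y :: "real \<times> 'a"
      obtain n where "\<bar>fst y\<bar> \<le> real n"
        using real_arch_simple by blast
      then show "ennreal (?f y) \<le> (SUP n. ennreal (?f y) * indicator {y. \<bar>fst y\<bar> \<le> real n} y)"
        by (intro SUP_upper2 [of n]) auto
      show "(SUP n. ennreal (?f y) * indicator {y. \<bar>fst y\<bar> \<le> real n} y) \<le> ennreal (?f y)"
        by (intro SUP_least) (auto simp: indicator_def)
    qed
    also have "\<dots> = (SUP n. \<integral>\<^sup>+y. ennreal (?f y) * indicator {y. \<bar>fst y\<bar> \<le> real n} y \<partial>lborel)"
    proof (rule nn_integral_monotone_convergence_SUP)
      show "incseq (\<lambda>n y. ennreal (?f y) * indicator {y. \<bar>fst y\<bar> \<le> real n} y)"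
        by (auto simp: incseq_def le_fun_def indicator_def)
      show "(\<lambda>y. ennreal (?f y) * indicator {y. \<bar>fst y\<bar> \<le> real n} y) \<in> borel_measurable lborel" for n
        using f_meas by (simp add: borel_prod [symmetric])
    qed
    also have "\<dots> \<le> ?B"
    proof (rule SUP_least)
      fix n
      \<comment> \<open>The choice \<open>\<epsilon> = 1 / n\<close> excludes \<open>n = 0\<close>,
        hence the passage to \<open>Suc n\<close>.\<close>
      have "(\<integral>\<^sup>+y. ennreal (?f y) * indicator {y. \<bar>fst y\<bar> \<le> real n} y \<partial>lborel)
        \<le> (\<integral>\<^sup>+y. ennreal (?f y) * indicator {y. \<bar>fst y\<bar> \<le> real (Suc n)} y \<partial>lborel)"
        by (intro nn_integral_mono mult_left_mono) (auto simp: indicator_def)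
      also have "\<dots> \<le> ?B"
        by (rule bound) simp
      finally show "(\<integral>\<^sup>+y. ennreal (?f y) * indicator {y. \<bar>fst y\<bar> \<le> real n} y \<partial>lborel) \<le> ?B" .
    qed
    finally show ?thesis .
  qed
  show ?thesis
    using C0 main by blast
qed

text \<open>By the band condition only phases \<open>\<bar>p \<xi> - p \<eta>\<bar> \<le> R\<close> contribute, and on these the kernel has
  Fourier transform \<open>1\<close>.\<close>

lemma osc_reproducing:
  fixes \<beta> :: "'a::euclidean_space \<Rightarrow> real" and p :: "'a \<Rightarrow> real"
  assumes \<beta>: "integrable lborel \<beta>" "\<And>x. 0 \<le> \<beta> x"
    and band: "\<And>\<zeta>. r < norm \<zeta> \<Longrightarrow> (LINT x|lborel. complex_of_real (\<beta> x) * cis (x \<bullet> \<zeta>)) = 0"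
    and g: "integrable lborel g" and p: "p \<in> borel_measurable borel" and R: "R > 0"
    and R': "\<And>\<xi> \<eta>. g \<xi> \<noteq> 0 \<Longrightarrow> g \<eta> \<noteq> 0 \<Longrightarrow> norm (\<xi> - \<eta>) \<le> r \<Longrightarrow> \<bar>p \<xi> - p \<eta>\<bar> \<le> R"
  shows "(\<integral>\<^sup>+x. ennreal (\<beta> x * (norm (osc p g t x))\<^sup>2) \<partial>lborel) \<le>
    (\<integral>\<^sup>+y. ennreal (\<bar>R * dlvp (R * (t - fst y))\<bar> * (\<beta> (snd y) * (norm (osc p g (fst y) (snd y)))\<^sup>2)) \<partial>lborel)"
proof -
  let ?w = "\<lambda>s. R * dlvp (R * (t - s))"
  let ?X = "\<lambda>\<zeta>. LINT x|lborel. complex_of_real (\<beta> x) * cis (x \<bullet> \<zeta>)"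
  let ?f = "\<lambda>y. \<beta> (snd y) * (norm (osc p g (fst y) (snd y)))\<^sup>2"
  have "integrable lborel (\<lambda>s::real. 20 / fejer_mass * (1 / (1 + s\<^sup>2)))"
    by (intro integrable_mult_right integrable_inverse_1_plus_square_lborel)
  then have "integrable lborel dlvp"
    by (rule Bochner_Integration.integrable_bound)
       (use dlvp_bound fejer_mass_pos in \<open>auto simp: abs_mult abs_of_nonneg\<close>)
  then have w: "integrable lborel ?w"
    using R lborel_integrable_real_affine [of dlvp "- R" "R * t"] by (simp add: algebra_simps)
  \<comment> \<open>On time frequencies up to \<open>R\<close> the reflected and translated kernel
    acts like a point mass at \<open>t\<close>.\<close>
  have T: "(LINT s|lborel. complex_of_real (?w s) * cis (\<tau> * s)) = cis (\<tau> * t)" if "\<bar>\<tau>\<bar> \<le> R" for \<tau>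
  proof -
    have "(LINT s|lborel. complex_of_real (?w s) * cis (\<tau> * s))
        = (LINT s|lborel. complex_of_real (?w (t + (-1) * s)) * cis (\<tau> * (t + (-1) * s)))"
      by (subst lborel_integral_real_affine [of "-1" _ t]) auto
    also have "\<dots> = (LINT s|lborel. cis (\<tau> * t) * (complex_of_real (R * dlvp (R * s)) * cis (- \<tau> * s)))"
    proof (intro Bochner_Integration.integral_cong refl)
      fix s
      have "cis (\<tau> * (t + (-1) * s)) = cis (\<tau> * t) * cis (- \<tau> * s)"
        by (simp add: cis_mult algebra_simps)
      then show "complex_of_real (?w (t + (-1) * s)) * cis (\<tau> * (t + (-1) * s)) =
          cis (\<tau> * t) * (complex_of_real (R * dlvp (R * s)) * cis (- \<tau> * s))"
        by (simp add: mult_ac)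
    qed
    also have "\<dots> = cis (\<tau> * t) * 1"
      using has_bochner_integral_integral_eq [OF has_bochner_integral_dlvp [OF R, of "- \<tau>"]] that
      by (simp only: integral_mult_right_zero abs_minus)
    finally show ?thesis
      by simp
  qed
  have "g (fst q) * cnj (g (snd q)) * ((LINT s|lborel. complex_of_real (?w s) * cis ((p (fst q) - p (snd q)) * s)) * ?X (fst q - snd q))
    = g (fst q) * cnj (g (snd q)) * (cis ((p (fst q) - p (snd q)) * t) * ?X (fst q - snd q))" for q
  proof (cases "g (fst q) = 0 \<or> g (snd q) = 0 \<or> r < norm (fst q - snd q)")
    case True
    then show ?thesis
      using band by auto
  next
    case False
    then show ?thesis
      by (subst T) (auto intro!: R')
  qed
  then have "complex_of_real (LINT x|lborel. \<beta> x * (norm (osc p g t x))\<^sup>2) =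
      complex_of_real (LINT y|lborel. ?w (fst y) * \<beta> (snd y) * (norm (osc p g (fst y) (snd y)))\<^sup>2)"
    unfolding integral_osc_square [OF w \<beta>(1) g p] integral_osc_square_slice [OF \<beta>(1) g p] by (simp only:)
  then have eq: "(LINT x|lborel. \<beta> x * (norm (osc p g t x))\<^sup>2) =
      (LINT y|lborel. ?w (fst y) * \<beta> (snd y) * (norm (osc p g (fst y) (snd y)))\<^sup>2)"
    by (simp only: of_real_eq_iff)
  have "(\<integral>\<^sup>+x. ennreal (\<beta> x * (norm (osc p g t x))\<^sup>2) \<partial>lborel) = ennreal (LINT x|lborel. \<beta> x * (norm (osc p g t x))\<^sup>2)"
    using \<beta> by (intro nn_integral_eq_integral integrable_osc_square_slice [OF \<beta>(1) g p]) auto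
  \<comment> \<open>The kernel is signed, so positivity of the left side is followed by absolute
    values on the right.\<close>
  also have "\<dots> \<le> ennreal (norm (LINT y|lborel. ?w (fst y) * \<beta> (snd y) * (norm (osc p g (fst y) (snd y)))\<^sup>2))"
    unfolding eq by (intro ennreal_leI) simp
  also have "\<dots> \<le> (\<integral>\<^sup>+y. ennreal (norm (?w (fst y) * \<beta> (snd y) * (norm (osc p g (fst y) (snd y)))\<^sup>2)) \<partial>lborel)"
    by (rule integral_norm_bound_ennreal')
  also have "\<dots> = (\<integral>\<^sup>+y. ennreal (\<bar>?w (fst y)\<bar> * ?f y) \<partial>lborel)"
    using \<beta> by (simp add: abs_mult mult.assoc)
  finally show ?thesis .
qed

section \<open>Integrating the reproducing kernel over a time set\<close>

text \<open>The majorant of the kernel is nearly constant at unit scale, so it may be replaced by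
  local averages.\<close>

lemma inverse_1_plus_square_le:
  fixes a b :: real
  assumes "\<bar>b - a\<bar> \<le> 1"
  shows "1 / (1 + a\<^sup>2) \<le> 3 * (1 / (1 + b\<^sup>2))"
proof -
  have "\<bar>b\<bar> \<le> \<bar>a\<bar> + 1"
    using assms by linarith
  then have "b\<^sup>2 \<le> (\<bar>a\<bar> + 1)\<^sup>2"
    by (metis abs_ge_zero power2_abs power_mono)
  also have "\<dots> \<le> 2 + 2 * a\<^sup>2"
    using sum_squares_bound [of "\<bar>a\<bar>" 1] by (simp add: power2_sum)
  finally have "1 + b\<^sup>2 \<le> 3 * (1 + a\<^sup>2)"
    using zero_le_power2 [of a] unfolding distrib_left by linarith
  moreover have "0 < 1 + a\<^sup>2" "0 < 1 + b\<^sup>2"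
    by (simp_all add: add_pos_nonneg)
  ultimately show ?thesis
    by (simp add: field_simps)
qed

text \<open>The majorant at \<open>t\<close> is at most 3 times its average over the window of
  radius \<open>1 / R\<close> around \<open>t\<close>. After exchanging the integrals,
  \<open>A\<close> enters only through its measure in such windows. The constant 30 is 20 from
  \<open>dlvp_bound\<close> times 3/2.\<close>

lemma nn_integral_dlvp_le:
  fixes A :: "real set"
  assumes A [measurable]: "A \<in> sets borel" and R: "R > 0"
    and M: "\<And>u. emeasure lborel (A \<inter> {u - 1 / R..u + 1 / R}) \<le> M"
  shows "(\<integral>\<^sup>+t\<in>A. ennreal \<bar>R * dlvp (R * (t - s))\<bar> \<partial>lborel)
     \<le> ennreal (30 / fejer_mass * (LINT x|lborel. 1 / (1 + x\<^sup>2)) * R) * M"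
proof -
  let ?k = "\<lambda>u::real. 1 / (1 + (R * (u - s))\<^sup>2)"
  let ?I = "\<lambda>t u. indicator {t - 1 / R..t + 1 / R} u :: ennreal"
  have k: "?k t \<le> 3 * ?k u" if "u \<in> {t - 1 / R..t + 1 / R}" for t u
  proof -
    let ?a = "R * (t - s)" and ?b = "R * (u - s)"
    have "R * \<bar>u - t\<bar> \<le> R * (1 / R)"
      using that R by (intro mult_left_mono) auto
    then have "\<bar>?b - ?a\<bar> \<le> 1"
      using R by (simp add: right_diff_distrib [symmetric] abs_mult del: right_diff_distrib)
    then show ?thesis
      by (rule inverse_1_plus_square_le)
  qed
  define c where "c = 20 / fejer_mass * R"
  have c: "0 \<le> c"
    using R fejer_mass_pos by (simp add: c_def)
  have 1: "ennreal \<bar>R * dlvp (R * (t - s))\<bar> \<le> (\<integral>\<^sup>+u. ennreal (3 / 2 * c * R * ?k u) * ?I t u \<partial>lborel)" for t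
  proof -
    have "\<bar>R * dlvp (R * (t - s))\<bar> \<le> R * (20 / fejer_mass / (1 + (R * (t - s))\<^sup>2))"
      unfolding abs_mult using R by (intro mult_mono dlvp_bound) auto
    \<comment> \<open>The factor \<open>2 / R\<close> is the length of the window and is about to
      become an integral over it.\<close>
    also have "\<dots> = R / 2 * c * ?k t * (2 / R)"
      using R by (simp add: c_def)
    finally have "ennreal \<bar>R * dlvp (R * (t - s))\<bar> \<le> ennreal (R / 2 * c * ?k t * (2 / R))"
      by (rule ennreal_leI)
    also have "\<dots> = ennreal (R / 2 * c * ?k t) * ennreal (2 / R)"
      using R c by (intro ennreal_mult) auto
    also have "ennreal (2 / R) = emeasure lborel {t - 1 / R..t + 1 / R}"
      using R by simp
    also have "ennreal (R / 2 * c * ?k t) * emeasure lborel {t - 1 / R..t + 1 / R}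
        = (\<integral>\<^sup>+u. ennreal (R / 2 * c * ?k t) * ?I t u \<partial>lborel)"
      by (rule nn_integral_cmult_indicator [symmetric]) simp
    also have "\<dots> \<le> (\<integral>\<^sup>+u. ennreal (3 / 2 * c * R * ?k u) * ?I t u \<partial>lborel)"
    proof (intro nn_integral_mono)
      fix u
      have "R / 2 * c * ?k t \<le> 3 / 2 * c * R * ?k u" if "u \<in> {t - 1 / R..t + 1 / R}"
      proof -
        have "R / 2 * c * ?k t \<le> R / 2 * c * (3 * ?k u)"
          using R c by (intro mult_left_mono k that) auto
        then show ?thesis
          by (simp add: mult_ac)
      qed
      then show "ennreal (R / 2 * c * ?k t) * ?I t u \<le> ennreal (3 / 2 * c * R * ?k u) * ?I t u"
        by (auto simp: indicator_def intro!: ennreal_leI)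
    qed
    finally show ?thesis .
  qed
  have m: "(\<lambda>(t, u). ennreal (3 / 2 * c * R * ?k u) * ?I t u * indicator A t) \<in> borel_measurable (lborel \<Otimes>\<^sub>M lborel)"
  proof -
    have "(\<lambda>(t, u). indicator {t - 1 / R..t + 1 / R} u :: ennreal) =
       (\<lambda>x. indicator {x. fst x - 1 / R \<le> snd x \<and> snd x \<le> fst x + 1 / R} x)"
      by (auto simp: indicator_def)
    moreover have "\<dots> \<in> borel_measurable (lborel \<Otimes>\<^sub>M lborel)"
    proof (rule borel_measurable_indicator)
      have "Measurable.pred (lborel \<Otimes>\<^sub>M lborel) (\<lambda>x. fst x - 1 / R \<le> snd x \<and> snd x \<le> fst x + 1 / R)"
        by measurable
      then show "{x. fst x - 1 / R \<le> snd x \<and> snd x \<le> fst x + 1 / R} \<in> sets (lborel \<Otimes>\<^sub>M lborel)"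
        by (simp add: pred_def space_pair_measure)
    qed
    ultimately have [measurable]: "(\<lambda>x. indicator {fst x - 1 / R..fst x + 1 / R} (snd x) :: ennreal)
        \<in> borel_measurable (lborel \<Otimes>\<^sub>M lborel)"
      by (simp add: split_def)
    show ?thesis
      unfolding split_def by measurable
  qed
  have "(\<integral>\<^sup>+t\<in>A. ennreal \<bar>R * dlvp (R * (t - s))\<bar> \<partial>lborel)
     \<le> (\<integral>\<^sup>+t\<in>A. (\<integral>\<^sup>+u. ennreal (3 / 2 * c * R * ?k u) * ?I t u \<partial>lborel) \<partial>lborel)"
    by (intro nn_integral_mono mult_right_mono 1) auto
  also have "\<dots> = (\<integral>\<^sup>+t. \<integral>\<^sup>+u. ennreal (3 / 2 * c * R * ?k u) * ?I t u * indicator A t \<partial>lborel \<partial>lborel)"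
    by (intro nn_integral_cong nn_integral_multc [symmetric]) simp
  also have "\<dots> = (\<integral>\<^sup>+u. \<integral>\<^sup>+t. ennreal (3 / 2 * c * R * ?k u) * ?I t u * indicator A t \<partial>lborel \<partial>lborel)"
    using lborel_pair.Fubini' [OF m] by simp
  \<comment> \<open>Being within \<open>1 / R\<close> is symmetric in \<open>t\<close> and
    \<open>u\<close>, so the window now sits around \<open>u\<close> and cuts out a piece of
    \<open>A\<close>.\<close>
  also have "\<dots> = (\<integral>\<^sup>+u. \<integral>\<^sup>+t. ennreal (3 / 2 * c * R * ?k u) * indicator (A \<inter> {u - 1 / R..u + 1 / R}) t \<partial>lborel \<partial>lborel)"
    by (intro nn_integral_cong) (auto simp: indicator_def)
  also have "\<dots> = (\<integral>\<^sup>+u. ennreal (3 / 2 * c * R * ?k u) * emeasure lborel (A \<inter> {u - 1 / R..u + 1 / R}) \<partial>lborel)"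
    by (intro nn_integral_cong nn_integral_cmult_indicator) simp
  also have "\<dots> \<le> (\<integral>\<^sup>+u. ennreal (3 / 2 * c * R * ?k u) * M \<partial>lborel)"
    by (intro nn_integral_mono mult_left_mono M) auto
  also have "\<dots> = (\<integral>\<^sup>+u. ennreal (3 / 2 * c * R * ?k u) \<partial>lborel) * M"
    by (intro nn_integral_multc) simp
  also have "(\<integral>\<^sup>+u. ennreal (3 / 2 * c * R * ?k u) \<partial>lborel) = ennreal (LINT u|lborel. 3 / 2 * c * R * ?k u)"
  proof (rule nn_integral_eq_integral)
    show "integrable lborel (\<lambda>u. 3 / 2 * c * R * ?k u)"
      using lborel_integrable_real_affine [OF integrable_inverse_1_plus_square_lborel, of R "- R * s"] R
      by (intro integrable_mult_right) (simp add: algebra_simps)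
  qed (use R c in auto)
  also have "(LINT u|lborel. 3 / 2 * c * R * ?k u) = 3 / 2 * c * (R * (LINT u|lborel. ?k u))"
    by (simp only: integral_mult_right_zero mult.assoc)
  also have "R * (LINT u|lborel. ?k u) = (LINT x|lborel. 1 / (1 + x\<^sup>2))"
    using R by (subst lborel_integral_real_affine [of R _ "- R * s"]) (auto simp: algebra_simps)
  also have "3 / 2 * c * (LINT x|lborel. 1 / (1 + x\<^sup>2)) = 30 / fejer_mass * (LINT x|lborel. 1 / (1 + x\<^sup>2)) * R"
    by (simp add: c_def)
  finally show ?thesis .
qed

section \<open>Time sets of bounded Assouad characteristic\<close>

text \<open>The reproducing formula costs \<open>M * R\<close> and local smoothing gains
  \<open>\<Lambda> powr (1 - \<gamma>)\<close>. Since \<open>R\<close> is of order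
  \<open>\<Lambda> powr (\<gamma> - 1)\<close>, only \<open>M\<close> is left, with a constant
  uniform in \<Lambda>.\<close>

lemma dispersive_neighbourhood_estimate:
  fixes z :: "'a::euclidean_space"
  assumes \<gamma>: "\<gamma> > 1"
  obtains C where "0 \<le> C" "\<And>\<Lambda> A M g. 2 \<le> \<Lambda> \<Longrightarrow> A \<in> sets borel \<Longrightarrow> 0 \<le> M \<Longrightarrow> integrable lborel g \<Longrightarrow>
     (\<And>\<xi>. g \<xi> \<noteq> 0 \<Longrightarrow> \<Lambda> / 4 \<le> norm \<xi> \<and> norm \<xi> \<le> 2 * \<Lambda>) \<Longrightarrow>
     (\<And>a. emeasure lborel (A \<inter> {a..a + \<Lambda> powr (1 - \<gamma>)}) \<le> ennreal M) \<Longrightarrow>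
     (\<integral>\<^sup>+t\<in>A. (\<integral>\<^sup>+x\<in>ball z 1. ennreal ((norm (osc (\<lambda>\<xi>. norm \<xi> powr \<gamma>) g t x))\<^sup>2) \<partial>lborel) \<partial>lborel)
     \<le> ennreal (C * M) * (\<integral>\<^sup>+\<xi>. ennreal ((norm (g \<xi>))\<^sup>2) \<partial>lborel)"
proof -
  obtain \<beta> \<kappa> where \<kappa>: "\<kappa> > 0" and \<beta>: "integrable lborel \<beta>" "\<And>x. 0 \<le> \<beta> x"
    and lower: "\<And>x. x \<in> ball z 1 \<Longrightarrow> \<kappa> \<le> \<beta> x"
    and band: "\<And>\<zeta>. 1 / 16 < norm \<zeta> \<Longrightarrow> (LINT x|lborel. complex_of_real (\<beta> x) * cis (x \<bullet> \<zeta>)) = 0"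
    using exists_bandlimited_bump [of "1 / 16" z] by auto
  let ?p = "\<lambda>\<xi>::'a. norm \<xi> powr \<gamma>"
  obtain C where C: "0 \<le> C" and smoothing: "\<And>\<Lambda> g. 2 \<le> \<Lambda> \<Longrightarrow> integrable lborel g \<Longrightarrow>
     (\<And>\<xi>. g \<xi> \<noteq> 0 \<Longrightarrow> \<Lambda> / 4 \<le> norm \<xi>) \<Longrightarrow>
     (\<integral>\<^sup>+y. ennreal (\<beta> (snd y) * (norm (osc ?p g (fst y) (snd y)))\<^sup>2) \<partial>lborel)
     \<le> ennreal (C * \<Lambda> powr (1 - \<gamma>)) * (\<integral>\<^sup>+\<xi>. ennreal ((norm (g \<xi>))\<^sup>2) \<partial>lborel)"
    using local_smoothing [OF \<gamma> \<beta> band] by blast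
  have [measurable]: "\<beta> \<in> borel_measurable borel"
    using \<beta> by (auto dest: borel_measurable_integrable)
  have p: "?p \<in> borel_measurable borel"
    by measurable
  define D where "D = 30 / fejer_mass * (LINT x::real|lborel. 1 / (1 + x\<^sup>2))"
  have D: "0 \<le> D"
    using fejer_mass_pos by (auto simp: D_def intro!: mult_nonneg_nonneg integral_nonneg)
  \<comment> \<open>In order: the lower bound of the bump, the kernel integral, the value of
    \<open>R * \<Lambda> powr (1 - \<gamma>)\<close>, and local smoothing.\<close>
  define C' where "C' = 1 / \<kappa> * D * (2 * \<gamma> * 2 powr (\<gamma> - 1)) * C"
  have C'0: "0 \<le> C'"
    using \<kappa> D C \<gamma> by (simp add: C'_def)
  have main: "(\<integral>\<^sup>+t\<in>A. (\<integral>\<^sup>+x\<in>ball z 1. ennreal ((norm (osc ?p g t x))\<^sup>2) \<partial>lborel) \<partial>lborel)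
     \<le> ennreal (C' * M) * (\<integral>\<^sup>+\<xi>. ennreal ((norm (g \<xi>))\<^sup>2) \<partial>lborel)"
    if \<Lambda>: "2 \<le> \<Lambda>" and A [measurable]: "A \<in> sets borel" and M: "0 \<le> M" and g: "integrable lborel g"
      and supp: "\<And>\<xi>. g \<xi> \<noteq> 0 \<Longrightarrow> \<Lambda> / 4 \<le> norm \<xi> \<and> norm \<xi> \<le> 2 * \<Lambda>"
      and AM: "\<And>a. emeasure lborel (A \<inter> {a..a + \<Lambda> powr (1 - \<gamma>)}) \<le> ennreal M"
    for \<Lambda> A M and g :: "'a \<Rightarrow> complex"
  proof -
    have [measurable]: "g \<in> borel_measurable borel"
      using g by (auto dest: borel_measurable_integrable)
    \<comment> \<open>Frequencies at distance at most 1/16 call for far less, but the factor 2 also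
      makes the window length \<open>2 / R\<close> at most
      \<open>\<Lambda> powr (1 - \<gamma>)\<close>.\<close>
    define R where "R = 2 * \<gamma> * (2 * \<Lambda>) powr (\<gamma> - 1)"
    have R: "0 < R"
      using \<gamma> \<Lambda> by (simp add: R_def)
    have R\<Lambda>: "R * \<Lambda> powr (1 - \<gamma>) = 2 * \<gamma> * 2 powr (\<gamma> - 1)"
    proof -
      have "R * \<Lambda> powr (1 - \<gamma>) = 2 * \<gamma> * 2 powr (\<gamma> - 1) * (\<Lambda> powr (\<gamma> - 1) * \<Lambda> powr (1 - \<gamma>))"
        using \<Lambda> by (simp add: R_def powr_mult)
      also have "\<Lambda> powr (\<gamma> - 1) * \<Lambda> powr (1 - \<gamma>) = 1"
        using \<Lambda> by (simp add: powr_add [symmetric])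
      finally show ?thesis
        by simp
    qed
    have AM': "emeasure lborel (A \<inter> {u - 1 / R..u + 1 / R}) \<le> ennreal M" for u
    proof -
      have "1 * 1 \<le> \<gamma> * 2 powr (\<gamma> - 1)"
        using \<gamma> by (intro mult_mono ge_one_powr_ge_zero) auto
      then have "2 \<le> R * \<Lambda> powr (1 - \<gamma>)"
        unfolding R\<Lambda> by simp
      then have "2 / R \<le> \<Lambda> powr (1 - \<gamma>)"
        using R by (simp add: field_simps)
      then have "A \<inter> {u - 1 / R..u + 1 / R} \<subseteq> A \<inter> {u - 1 / R..(u - 1 / R) + \<Lambda> powr (1 - \<gamma>)}"
        using R by (auto simp: field_simps)
      then have "emeasure lborel (A \<inter> {u - 1 / R..u + 1 / R}) \<le>
          emeasure lborel (A \<inter> {u - 1 / R..(u - 1 / R) + \<Lambda> powr (1 - \<gamma>)})"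
        by (intro emeasure_mono) auto
      with AM show ?thesis
        by (meson order_trans)
    qed
    have band': "\<bar>?p \<xi> - ?p \<eta>\<bar> \<le> R" if "g \<xi> \<noteq> 0" "g \<eta> \<noteq> 0" "norm (\<xi> - \<eta>) \<le> 1 / 16" for \<xi> \<eta>
    proof -
      have "\<Lambda> / 4 \<le> norm \<xi>" "norm \<xi> \<le> 2 * \<Lambda>" "\<Lambda> / 4 \<le> norm \<eta>" "norm \<eta> \<le> 2 * \<Lambda>"
        using that supp by auto
      then have "\<bar>?p \<xi> - ?p \<eta>\<bar> \<le> \<gamma> * (2 * \<Lambda>) powr (\<gamma> - 1) * \<bar>norm \<xi> - norm \<eta>\<bar>"
        using \<gamma> \<Lambda> by (intro powr_diff_le) linarith+
      also have "\<dots> \<le> \<gamma> * (2 * \<Lambda>) powr (\<gamma> - 1) * 2"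
        using norm_triangle_ineq3 [of \<xi> \<eta>] that \<gamma> by (intro mult_left_mono) auto
      finally show ?thesis
        by (simp add: R_def mult_ac)
    qed
    let ?f = "\<lambda>y. \<beta> (snd y) * (norm (osc ?p g (fst y) (snd y)))\<^sup>2"
    let ?w = "\<lambda>t s. \<bar>R * dlvp (R * (t - s))\<bar>"
    let ?G = "\<integral>\<^sup>+\<xi>. ennreal ((norm (g \<xi>))\<^sup>2) \<partial>lborel"
    have f_meas: "?f \<in> borel_measurable (borel \<Otimes>\<^sub>M borel)"
      by measurable
    then have f_meas' [measurable]: "?f \<in> borel_measurable borel"
      by (simp only: borel_prod)
    have "(\<integral>\<^sup>+x\<in>ball z 1. ennreal ((norm (osc ?p g t x))\<^sup>2) \<partial>lborel)
        \<le> ennreal (1 / \<kappa>) * (\<integral>\<^sup>+y. ennreal (?w t (fst y)) * ennreal (?f y) \<partial>lborel)" for t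
    proof -
      have [measurable]: "(\<lambda>x. osc ?p g t x) \<in> borel_measurable borel"
        unfolding osc_def by measurable
      have "(\<integral>\<^sup>+x\<in>ball z 1. ennreal ((norm (osc ?p g t x))\<^sup>2) \<partial>lborel)
         \<le> (\<integral>\<^sup>+x. ennreal (1 / \<kappa>) * ennreal (\<beta> x * (norm (osc ?p g t x))\<^sup>2) \<partial>lborel)"
      proof (intro nn_integral_mono)
        fix x
        show "ennreal ((norm (osc ?p g t x))\<^sup>2) * indicator (ball z 1) x
          \<le> ennreal (1 / \<kappa>) * ennreal (\<beta> x * (norm (osc ?p g t x))\<^sup>2)"
        proof (cases "x \<in> ball z 1")
          case True
          have "\<kappa> * (norm (osc ?p g t x))\<^sup>2 \<le> \<beta> x * (norm (osc ?p g t x))\<^sup>2"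
            using lower [OF True] by (intro mult_right_mono) auto
          then have "ennreal ((norm (osc ?p g t x))\<^sup>2) \<le> ennreal (1 / \<kappa> * (\<beta> x * (norm (osc ?p g t x))\<^sup>2))"
            using \<kappa> by (intro ennreal_leI) (simp add: field_simps)
          also have "\<dots> = ennreal (1 / \<kappa>) * ennreal (\<beta> x * (norm (osc ?p g t x))\<^sup>2)"
            using \<kappa> by (intro ennreal_mult') auto
          finally show ?thesis
            using True by simp
        qed simp
      qed
      also have "\<dots> = ennreal (1 / \<kappa>) * (\<integral>\<^sup>+x. ennreal (\<beta> x * (norm (osc ?p g t x))\<^sup>2) \<partial>lborel)"
        by (intro nn_integral_cmult) measurable
      also have "\<dots> \<le> ennreal (1 / \<kappa>) * (\<integral>\<^sup>+y. ennreal (?w t (fst y) * ?f y) \<partial>lborel)"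
        by (intro mult_left_mono osc_reproducing [where r = "1 / 16", OF \<beta> band g p R] band') auto
      finally show ?thesis
        by (simp add: ennreal_mult')
    qed
    then have "(\<integral>\<^sup>+t\<in>A. (\<integral>\<^sup>+x\<in>ball z 1. ennreal ((norm (osc ?p g t x))\<^sup>2) \<partial>lborel) \<partial>lborel)
      \<le> (\<integral>\<^sup>+t\<in>A. (ennreal (1 / \<kappa>) * (\<integral>\<^sup>+y. ennreal (?w t (fst y)) * ennreal (?f y) \<partial>lborel)) \<partial>lborel)"
      by (intro nn_integral_mono mult_right_mono) auto
    \<comment> \<open>All factors go under the inner integral so that the order of integration can
      be exchanged.\<close>
    also have "\<dots> = (\<integral>\<^sup>+t. \<integral>\<^sup>+y. ennreal (1 / \<kappa>) * (ennreal (?f y) * (ennreal (?w t (fst y)) * indicator A t)) \<partial>lborel \<partial>lborel)"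
    proof (intro nn_integral_cong)
      fix t
      have "(\<integral>\<^sup>+y. ennreal (1 / \<kappa>) * (ennreal (?f y) * (ennreal (?w t (fst y)) * indicator A t)) \<partial>lborel)
         = (\<integral>\<^sup>+y. (ennreal (1 / \<kappa>) * indicator A t) * (ennreal (?w t (fst y)) * ennreal (?f y)) \<partial>lborel)"
        by (simp add: mult_ac)
      also have "\<dots> = (ennreal (1 / \<kappa>) * indicator A t) * (\<integral>\<^sup>+y. ennreal (?w t (fst y)) * ennreal (?f y) \<partial>lborel)"
        using f_meas by (intro nn_integral_cmult) (simp add: borel_prod [symmetric])
      finally show "ennreal (1 / \<kappa>) * (\<integral>\<^sup>+y. ennreal (?w t (fst y)) * ennreal (?f y) \<partial>lborel) * indicator A t =
         (\<integral>\<^sup>+y. ennreal (1 / \<kappa>) * (ennreal (?f y) * (ennreal (?w t (fst y)) * indicator A t)) \<partial>lborel)"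
        by (simp add: mult_ac)
    qed
    also have "\<dots> = (\<integral>\<^sup>+y. \<integral>\<^sup>+t. ennreal (1 / \<kappa>) * (ennreal (?f y) * (ennreal (?w t (fst y)) * indicator A t)) \<partial>lborel \<partial>lborel)"
    proof -
      have "(\<lambda>x. ?f (snd x)) \<in> borel_measurable (borel \<Otimes>\<^sub>M (borel \<Otimes>\<^sub>M borel))"
        using f_meas by (rule measurable_compose [OF measurable_snd])
      then have "(\<lambda>(t, y). ennreal (1 / \<kappa>) * (ennreal (?f y) * (ennreal (?w t (fst y)) * indicator A t)))
          \<in> borel_measurable (borel \<Otimes>\<^sub>M (borel \<Otimes>\<^sub>M borel))"
        unfolding split_def by measurable
      then have "(\<lambda>(t, y). ennreal (1 / \<kappa>) * (ennreal (?f y) * (ennreal (?w t (fst y)) * indicator A t)))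
          \<in> borel_measurable (lborel \<Otimes>\<^sub>M lborel)"
        by (simp add: borel_prod lborel_prod)
      from lborel_pair.Fubini' [OF this] show ?thesis
        by simp
    qed
    also have "\<dots> = (\<integral>\<^sup>+y. ennreal (1 / \<kappa>) * (ennreal (?f y) * (\<integral>\<^sup>+t\<in>A. ennreal (?w t (fst y)) \<partial>lborel)) \<partial>lborel)"
      by (simp add: nn_integral_cmult)
    \<comment> \<open>The bound for the integral in \<open>t\<close> is uniform in the other time
      variable; what remains is the global integral of local smoothing.\<close>
    also have "\<dots> \<le> (\<integral>\<^sup>+y. ennreal (1 / \<kappa>) * (ennreal (?f y) * (ennreal (D * R) * ennreal M)) \<partial>lborel)"
      unfolding D_def by (intro nn_integral_mono mult_left_mono nn_integral_dlvp_le A R AM') auto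
    also have "\<dots> = (\<integral>\<^sup>+y. ennreal (1 / \<kappa> * D * R * M) * ennreal (?f y) \<partial>lborel)"
    proof -
      have "ennreal (1 / \<kappa> * D * R * M) = ennreal (1 / \<kappa>) * (ennreal (D * R) * ennreal M)"
        using \<kappa> D R M by (subst ennreal_mult' [symmetric]; simp add: mult_ac)+
      then show ?thesis
        by (simp add: mult_ac)
    qed
    also have "\<dots> = ennreal (1 / \<kappa> * D * R * M) * (\<integral>\<^sup>+y. ennreal (?f y) \<partial>lborel)"
      by (intro nn_integral_cmult) measurable
    also have "\<dots> \<le> ennreal (1 / \<kappa> * D * R * M) * (ennreal (C * \<Lambda> powr (1 - \<gamma>)) * ?G)"
      using supp by (intro mult_left_mono smoothing \<Lambda> g) auto
    also have "\<dots> = ennreal (1 / \<kappa> * D * R * M * (C * \<Lambda> powr (1 - \<gamma>))) * ?G"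
      using \<kappa> D R M C by (subst (2) ennreal_mult) (auto simp: mult_ac)
    also have "1 / \<kappa> * D * R * M * (C * \<Lambda> powr (1 - \<gamma>)) = C' * M"
      unfolding C'_def R\<Lambda> [symmetric] by simp
    finally show ?thesis .
  qed
  show ?thesis
    using C'0 main by (rule that)
qed

section \<open>Covering numbers and the measure of neighbourhoods of \<open>E\<close>\<close>

text \<open>The value of \<open>LEAST\<close> has its defining property only once some cover is
  known; a grid of adjacent closed intervals is one.\<close>

lemma covering_number_attained:
  assumes A: "A \<subseteq> {0..1}" and \<delta>: "\<delta> > 0"
  obtains F where "finite F" "card F = covering_number A \<delta>"
    "\<And>J. J \<in> F \<Longrightarrow> is_interval J \<and> measure lborel J = \<delta>" "A \<subseteq> \<Union>F"
proof -
  let ?P = "\<lambda>n. \<exists>F. finite F \<and> card F = n \<and>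
        (\<forall>J\<in>F. is_interval J \<and> measure lborel J = \<delta>) \<and> A \<subseteq> \<Union>F"
  define m where "m = nat \<lceil>1 / \<delta>\<rceil>"
  define F where "F = (\<lambda>k::nat. {real k * \<delta>..real k * \<delta> + \<delta>}) ` {..m}"
  have "A \<subseteq> \<Union>F"
  proof
    fix x assume "x \<in> A"
    then have x: "0 \<le> x" "x \<le> 1"
      using A by auto
    define k where "k = nat \<lfloor>x / \<delta>\<rfloor>"
    have k: "real k \<le> x / \<delta>" "x / \<delta> \<le> real k + 1"
      using x \<delta> by (auto simp: k_def intro: less_imp_le)
    have "x / \<delta> \<le> 1 / \<delta>"
      using x \<delta> by (simp add: divide_right_mono)
    then have "k \<le> m"
      unfolding k_def m_def by (intro nat_mono) linarith
    moreover have "x \<in> {real k * \<delta>..real k * \<delta> + \<delta>}"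
      using k \<delta> by (simp add: field_simps)
    ultimately show "x \<in> \<Union>F"
      by (auto simp: F_def)
  qed
  moreover have "is_interval J \<and> measure lborel J = \<delta>" if "J \<in> F" for J
    using that \<delta> by (auto simp: F_def is_interval_cc)
  ultimately have "?P (card F)"
    by (intro exI [of _ F]) (auto simp: F_def)
  then have "?P (covering_number A \<delta>)"
    unfolding covering_number_def by (rule LeastI)
  then show ?thesis
    using that by blast
qed

lemma interval_subset_cball:
  fixes J :: "real set"
  assumes J: "is_interval J" "measure lborel J = \<delta>" "\<delta> > 0" and p: "p \<in> J"
  shows "J \<subseteq> cball p \<delta>"
proof
  fix q assume q: "q \<in> J"
  have sets: "J \<in> sets lborel"
    using real_interval_borel_measurable [OF J(1)] by simp
  \<comment> \<open>An infinite measure would make \<open>measure\<close> equal to 0, so \<delta> >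
    0 rules out unbounded intervals.\<close>
  have fin: "emeasure lborel J \<noteq> \<infinity>"
    using J(2,3) unfolding measure_def by force
  have "{min p q..max p q} \<subseteq> J"
  proof
    fix x assume "x \<in> {min p q..max p q}"
    then have "p \<le> x \<and> x \<le> q \<or> q \<le> x \<and> x \<le> p"
      by auto
    then show "x \<in> J"
      using J(1) p q unfolding is_interval_1 by blast
  qed
  then have "measure lborel {min p q..max p q} \<le> measure lborel J"
    using sets fin by (intro measure_mono_fmeasurable fmeasurableI) (auto simp: less_top)
  then have "max p q - min p q \<le> \<delta>"
    unfolding J(2) by (simp split: if_splits)
  then show "q \<in> cball p \<delta>"
    by (simp add: dist_real_def)
qed

lemma nbhd_memD:
  assumes "t \<in> nbhd E \<delta>"
  shows "\<exists>x\<in>E. \<bar>t - x\<bar> < \<delta>"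
proof -
  have "E \<noteq> {}" "infdist t E < \<delta>"
    using assms by (auto simp: nbhd_def)
  moreover have "bdd_below ((\<lambda>x. dist t x) ` E)"
    by (rule bdd_belowI2 [of _ 0]) simp
  ultimately have "\<exists>x\<in>E. dist t x < \<delta>"
    using cINF_less_iff [of E "dist t" \<delta>] unfolding infdist_def by auto
  then show ?thesis
    by (simp add: dist_real_def)
qed

lemma nbhd_sets [measurable]: "nbhd E \<delta> \<in> sets borel"
proof (cases "E = {}")
  case False
  have "open {t. infdist t E < \<delta>}"
    by (intro open_Collect_less continuous_intros)
  then show ?thesis
    using False by (simp add: nbhd_def)
qed (simp add: nbhd_def)

text \<open>Each covering interval lies within \<delta> of one of its points, so its
  \<delta>-neighbourhood lies in an interval of length \<open>4 * \<delta>\<close>.\<close>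

lemma emeasure_nbhd_le_covering_number:
  assumes E: "E \<subseteq> {0..1}" and \<delta>: "\<delta> > 0"
  shows "emeasure lborel (nbhd E \<delta>) \<le> ennreal (4 * \<delta> * real (covering_number E \<delta>))"
proof -
  obtain F where F: "finite F" "card F = covering_number E \<delta>"
    "\<And>J. J \<in> F \<Longrightarrow> is_interval J \<and> measure lborel J = \<delta>" "E \<subseteq> \<Union>F"
    using covering_number_attained [OF E \<delta>] by blast
  have "\<exists>p. J \<subseteq> cball p \<delta>" if "J \<in> F" for J
    using interval_subset_cball [of J \<delta>] F(3) [OF that] \<delta> by (cases "J = {}") blast+
  then obtain p where p: "\<And>J. J \<in> F \<Longrightarrow> J \<subseteq> cball (p J) \<delta>"
    by metis
  have "nbhd E \<delta> \<subseteq> (\<Union>J\<in>F. {p J - 2 * \<delta>..p J + 2 * \<delta>})"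
  proof
    fix t assume "t \<in> nbhd E \<delta>"
    then obtain x where x: "x \<in> E" "\<bar>t - x\<bar> < \<delta>"
      using nbhd_memD by blast
    then obtain J where J: "J \<in> F" "x \<in> J"
      using F by blast
    have "\<bar>p J - x\<bar> \<le> \<delta>"
      using subsetD [OF p [OF J(1)] J(2)] by (simp add: dist_real_def)
    then have "t \<in> {p J - 2 * \<delta>..p J + 2 * \<delta>}"
      using x by auto
    then show "t \<in> (\<Union>J\<in>F. {p J - 2 * \<delta>..p J + 2 * \<delta>})"
      using J by blast
  qed
  then have "emeasure lborel (nbhd E \<delta>) \<le> emeasure lborel (\<Union>J\<in>F. {p J - 2 * \<delta>..p J + 2 * \<delta>})"
    using F by (intro emeasure_mono) auto
  also have "\<dots> \<le> (\<Sum>J\<in>F. emeasure lborel {p J - 2 * \<delta>..p J + 2 * \<delta>})"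
    using F by (intro emeasure_subadditive_finite) auto
  also have "\<dots> = ennreal (4 * \<delta> * real (card F))"
    using \<delta> by (simp add: ennreal_mult' [symmetric] ennreal_of_nat_eq_real_of_nat mult_ac ennreal_mult'' [symmetric])
  finally show ?thesis
    using F by simp
qed

lemma covering_number_le_assouad:
  assumes I: "I = {c..c + L}" "I \<subseteq> {0..1}" and L: "0 < L"
    and K: "assouad_char \<alpha> \<theta> E \<le> ennreal K" "0 \<le> K"
  shows "(L powr (1 / \<theta>) / L) powr \<alpha> * real (covering_number (E \<inter> I) (L powr (1 / \<theta>))) \<le> K"
proof -
  have m: "measure lborel I = L"
    using I L by simp
  have "is_interval I"
    using I by (simp add: is_interval_cc)
  then have "ennreal ((measure lborel I powr (1 / \<theta>) / measure lborel I) powr \<alpha> *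
      real (covering_number (E \<inter> I) (measure lborel I powr (1 / \<theta>)))) \<le> assouad_char \<alpha> \<theta> E"
    unfolding assouad_char_def using I L m by (intro SUP_upper) auto
  also have "\<dots> \<le> ennreal K"
    by fact
  finally show ?thesis
    using K unfolding m by (subst (asm) ennreal_le_iff) auto
qed

text \<open>Three intervals of length \<open>\<Lambda> powr (1 - \<gamma>)\<close> contain all
  points of \<open>E\<close> that matter. The Assouad bound allows at most
  \<open>K * \<Lambda> powr \<alpha>\<close> covering intervals of length
  \<open>\<Lambda> powr (- \<gamma>)\<close> for each, and the neighbourhood of each of these has
  measure at most four times its length.\<close>

lemma emeasure_nbhd_Int_le:
  assumes E: "E \<subseteq> {0..1}" and \<gamma>: "\<gamma> > 1" and \<Lambda>: "\<Lambda> \<ge> 2"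
    and K: "assouad_char \<alpha> ((\<gamma> - 1) / \<gamma>) E \<le> ennreal K" "0 \<le> K"
  shows "emeasure lborel (nbhd E (\<Lambda> powr (- \<gamma>)) \<inter> {a..a + \<Lambda> powr (1 - \<gamma>)})
     \<le> ennreal (12 * K * \<Lambda> powr (\<alpha> - \<gamma>))"
proof -
  define L where "L = \<Lambda> powr (1 - \<gamma>)"
  define \<delta> where "\<delta> = \<Lambda> powr (- \<gamma>)"
  have L: "0 < L" "L \<le> 1"
    using \<gamma> \<Lambda> powr_mono [of "1 - \<gamma>" 0 \<Lambda>] by (auto simp: L_def)
  have \<delta>: "0 < \<delta>" "\<delta> \<le> L"
    using \<Lambda> powr_mono [of "- \<gamma>" "1 - \<gamma>" \<Lambda>] by (auto simp: L_def \<delta>_def)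
  \<comment> \<open>For the exponent \<open>(\<gamma> - 1) / \<gamma>\<close> the covering scale
    attached to intervals of length \<open>L\<close> is exactly the width of the
    neighbourhood.\<close>
  have L\<delta>: "L powr (1 / ((\<gamma> - 1) / \<gamma>)) = \<delta>"
  proof -
    have "(1 - \<gamma>) * (1 / ((\<gamma> - 1) / \<gamma>)) = - \<gamma>"
      using \<gamma> by (simp add: field_simps)
    then show ?thesis
      by (simp add: L_def \<delta>_def powr_powr)
  qed
  have \<delta>L: "(\<delta> / L) powr \<alpha> = \<Lambda> powr (- \<alpha>)"
  proof -
    have "\<delta> / L = \<Lambda> powr (- \<gamma> - (1 - \<gamma>))"
      unfolding L_def \<delta>_def by (rule powr_diff [symmetric])
    also have "- \<gamma> - (1 - \<gamma>) = - 1"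
      by simp
    finally show ?thesis
      by (simp only: powr_powr) simp
  qed
  have piece: "emeasure lborel (nbhd (E \<inter> {c..c + L}) \<delta>) \<le> ennreal (4 * K * \<Lambda> powr (\<alpha> - \<gamma>))"
    if c: "0 \<le> c" "c \<le> 1 - L" for c
  proof -
    have "(\<delta> / L) powr \<alpha> * real (covering_number (E \<inter> {c..c + L}) \<delta>) \<le> K"
      using covering_number_le_assouad [OF refl _ L(1) K, of c] c unfolding L\<delta> by auto
    then have "\<Lambda> powr \<alpha> * (\<Lambda> powr (- \<alpha>) * real (covering_number (E \<inter> {c..c + L}) \<delta>)) \<le> \<Lambda> powr \<alpha> * K"
      unfolding \<delta>L by (intro mult_left_mono) auto
    then have N: "real (covering_number (E \<inter> {c..c + L}) \<delta>) \<le> \<Lambda> powr \<alpha> * K"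
      using \<Lambda> by (simp add: mult.assoc [symmetric] powr_add [symmetric])
    have "emeasure lborel (nbhd (E \<inter> {c..c + L}) \<delta>)
        \<le> ennreal (4 * \<delta> * real (covering_number (E \<inter> {c..c + L}) \<delta>))"
      using E \<delta> by (intro emeasure_nbhd_le_covering_number) auto
    also have "\<dots> \<le> ennreal (4 * \<delta> * (\<Lambda> powr \<alpha> * K))"
      using N \<delta> by (intro ennreal_leI mult_left_mono) auto
    also have "4 * \<delta> * (\<Lambda> powr \<alpha> * K) = 4 * K * \<Lambda> powr (\<alpha> - \<gamma>)"
      using \<Lambda> by (simp add: \<delta>_def powr_diff powr_minus field_simps)
    finally show ?thesis .
  qed
  \<comment> \<open>As \<delta> \<le> L, the relevant points lie in
    \<open>{a - L..a + 2 * L}\<close>, which is cut into three. The clamping moves each piece into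
    [0, 1], as the Assouad characteristic demands, without losing points of [0, 1].\<close>
  define c where "c i = max 0 (min (1 - L) (a + (real i - 1) * L))" for i :: nat
  have c: "0 \<le> c i" "c i \<le> 1 - L" for i
    using L by (auto simp: c_def)
  have "nbhd E \<delta> \<inter> {a..a + L} \<subseteq> (\<Union>i<3. nbhd (E \<inter> {c i..c i + L}) \<delta>)"
  proof
    fix t assume t: "t \<in> nbhd E \<delta> \<inter> {a..a + L}"
    then obtain x where x: "x \<in> E" "\<bar>t - x\<bar> < \<delta>"
      using nbhd_memD by blast
    then have x01: "0 \<le> x" "x \<le> 1"
      using E by auto
    have "a - L \<le> x" "x \<le> a + 2 * L"
      using x t \<delta> by auto
    then have "\<exists>i<3::nat. a + (real i - 1) * L \<le> x \<and> x \<le> a + (real i - 1) * L + L"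
    proof -
      consider "x \<le> a" | "a < x" "x \<le> a + L" | "a + L < x"
        by linarith
      then show ?thesis
      proof cases
        case 1
        then show ?thesis
          using \<open>a - L \<le> x\<close> by (intro exI [of _ 0]) auto
      next
        case 2
        then show ?thesis
          by (intro exI [of _ 1]) auto
      next
        case 3
        then show ?thesis
          using \<open>x \<le> a + 2 * L\<close> by (intro exI [of _ 2]) auto
      qed
    qed
    then obtain i :: nat where i: "i < 3" "a + (real i - 1) * L \<le> x" "x \<le> a + (real i - 1) * L + L"
      by blast
    then have xi: "x \<in> E \<inter> {c i..c i + L}"
      using x x01 L by (auto simp: c_def max_def min_def)
    then have "infdist t (E \<inter> {c i..c i + L}) < \<delta>"
      using infdist_le [OF xi, of t] x by (simp add: dist_real_def)
    then have "t \<in> nbhd (E \<inter> {c i..c i + L}) \<delta>"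
      using xi by (auto simp: nbhd_def)
    then show "t \<in> (\<Union>i<3. nbhd (E \<inter> {c i..c i + L}) \<delta>)"
      using i by blast
  qed
  then have "emeasure lborel (nbhd E \<delta> \<inter> {a..a + L}) \<le> emeasure lborel (\<Union>i<3. nbhd (E \<inter> {c i..c i + L}) \<delta>)"
    by (intro emeasure_mono) auto
  also have "\<dots> \<le> (\<Sum>i<3. emeasure lborel (nbhd (E \<inter> {c i..c i + L}) \<delta>))"
    by (intro emeasure_subadditive_finite) auto
  also have "\<dots> \<le> (\<Sum>i<3::nat. ennreal (4 * K * \<Lambda> powr (\<alpha> - \<gamma>)))"
    by (intro sum_mono piece c)
  also have "\<dots> = ennreal (12 * K * \<Lambda> powr (\<alpha> - \<gamma>))"
    using K by (subst sum_ennreal) auto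
  finally show ?thesis
    by (simp add: \<delta>_def L_def)
qed

section \<open>Littlewood--Paley pieces\<close>

lemma norm_propagator_le:
  fixes g :: "'a::euclidean_space \<Rightarrow> complex"
  shows "norm (propagator \<gamma> t g x) \<le> norm (osc (\<lambda>\<xi>. norm \<xi> powr \<gamma>) g t x)"
proof -
  have "propagator \<gamma> t g x =
      complex_of_real ((2 * pi) powr (- real DIM('a))) * osc (\<lambda>\<xi>. norm \<xi> powr \<gamma>) g t x"
    by (simp add: propagator_def osc_def cis_conv_exp)
  moreover have "(2 * pi) powr (- real DIM('a)) \<le> (2 * pi) powr 0"
    using pi_gt3 by (intro powr_mono) auto
  then have "(2 * pi) powr (- real DIM('a)) \<le> 1"
    by simp
  ultimately show ?thesis
    by (simp only: norm_mult norm_of_real abs_of_nonneg [OF powr_ge_zero]) (rule mult_left_le_one_le; simp)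
qed

lemma ennsqrt_power2: "(ennsqrt a)\<^sup>2 = a"
  by (cases a) (auto simp: ennsqrt_def ennreal_power)

lemma ennsqrt_mono: "a \<le> b \<Longrightarrow> ennsqrt a \<le> ennsqrt b"
  by (cases a; cases b) (auto simp: ennsqrt_def ennreal_leI top_unique)

lemma ennsqrt_less_top: "ennsqrt a < \<infinity> \<longleftrightarrow> a < \<infinity>"
  by (cases a) (auto simp: ennsqrt_def)

lemma ennreal_mult_mult: "0 \<le> a \<Longrightarrow> ennreal a * (ennreal b * w) = ennreal (a * b) * w"
  by (simp add: ennreal_mult' mult.assoc)

lemma ennsqrt_mult_left:
  assumes "0 \<le> c" "a < \<infinity>"
  shows "ennsqrt (ennreal c * a) = ennreal (sqrt c) * ennsqrt a"
  using assms by (cases a) (auto simp: ennsqrt_def ennreal_mult [symmetric] real_sqrt_mult)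

text \<open>Squaring in the outer integral undoes the inner root, so the mixed norm is the root of a
  single iterated integral.\<close>

lemma mixed_norm_le:
  assumes "\<And>t x. norm (v t x) \<le> norm (F t x)"
    and "(\<integral>\<^sup>+t\<in>A. (\<integral>\<^sup>+x\<in>B. ennreal ((norm (F t x))\<^sup>2) \<partial>lborel) \<partial>lborel) \<le> b"
  shows "mixed_norm A B v \<le> ennsqrt b"
proof -
  have "(\<integral>\<^sup>+t\<in>A. (\<integral>\<^sup>+x\<in>B. (ennreal (norm (v t x)))\<^sup>2 \<partial>lborel) \<partial>lborel)
     \<le> (\<integral>\<^sup>+t\<in>A. (\<integral>\<^sup>+x\<in>B. ennreal ((norm (F t x))\<^sup>2) \<partial>lborel) \<partial>lborel)"
    using assms(1) by (intro nn_integral_mono mult_right_mono) (auto simp: ennreal_power intro!: ennreal_leI power_mono)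
  then show ?thesis
    using assms(2) unfolding mixed_norm_def L2_norm_on_def ennsqrt_power2 by (intro ennsqrt_mono) auto
qed

text \<open>On the ball that carries \<open>g\<close>, its modulus is at most
  \<open>1 + (norm (g \<xi>))\<^sup>2\<close>.\<close>

lemma integrable_of_square_integrable:
  fixes g :: "'a::euclidean_space \<Rightarrow> complex"
  assumes [measurable]: "g \<in> borel_measurable borel" and supp: "\<And>\<xi>. g \<xi> \<noteq> 0 \<Longrightarrow> norm \<xi> \<le> r"
    and fin: "(\<integral>\<^sup>+\<xi>. ennreal ((norm (g \<xi>))\<^sup>2) \<partial>lborel) < \<infinity>"
  shows "integrable lborel g"
proof (rule integrableI_bounded)
  have "ennreal (norm (g \<xi>)) \<le> indicator (cball 0 r) \<xi> + ennreal ((norm (g \<xi>))\<^sup>2)" for \<xi>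
  proof (cases "g \<xi> = 0")
    case False
    have "0 \<le> (norm (g \<xi>) - 1)\<^sup>2"
      by simp
    then have "norm (g \<xi>) \<le> 1 + (norm (g \<xi>))\<^sup>2"
      using norm_ge_zero [of "g \<xi>"] unfolding power2_diff by (simp del: norm_ge_zero)
    then have "ennreal (norm (g \<xi>)) \<le> ennreal (1 + (norm (g \<xi>))\<^sup>2)"
      by (rule ennreal_leI)
    also have "\<dots> = 1 + ennreal ((norm (g \<xi>))\<^sup>2)"
      by (subst ennreal_plus) auto
    finally show ?thesis
      using supp [OF False] by simp
  qed simp
  then have "(\<integral>\<^sup>+\<xi>. ennreal (norm (g \<xi>)) \<partial>lborel)
      \<le> (\<integral>\<^sup>+\<xi>. indicator (cball 0 r) \<xi> + ennreal ((norm (g \<xi>))\<^sup>2) \<partial>lborel)"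
    by (intro nn_integral_mono)
  also have "\<dots> = emeasure lborel (cball (0::'a) r) + (\<integral>\<^sup>+\<xi>. ennreal ((norm (g \<xi>))\<^sup>2) \<partial>lborel)"
    by (subst nn_integral_add) (auto intro: borel_measurable_indicator)
  also have "\<dots> < \<infinity>"
    using fin emeasure_lborel_cball_finite [of "0::'a" r] by (simp add: less_top)
  finally show "(\<integral>\<^sup>+\<xi>. ennreal (norm (g \<xi>)) \<partial>lborel) < \<infinity>" .
qed simp

text \<open>Cauchy-Schwarz on the ball that carries \<open>g\<close> bounds the evolution uniformly
  in time and space; the remaining factors are the volume of the unit ball and the length 3 of the
  time interval.\<close>

lemma low_frequency_estimate:
  fixes g :: "'a::euclidean_space \<Rightarrow> complex" and z :: 'a
  assumes [measurable]: "g \<in> borel_measurable borel" and supp: "\<And>\<xi>. g \<xi> \<noteq> 0 \<Longrightarrow> norm \<xi> \<le> r"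
    and A: "A \<in> sets borel" "A \<subseteq> {-1..2}"
  shows "(\<integral>\<^sup>+t\<in>A. (\<integral>\<^sup>+x\<in>ball z 1. ennreal ((norm (osc p g t x))\<^sup>2) \<partial>lborel) \<partial>lborel)
    \<le> ennreal (3 * measure lborel (ball z 1) * measure lborel (cball (0::'a) r)) *
       (\<integral>\<^sup>+\<xi>. ennreal ((norm (g \<xi>))\<^sup>2) \<partial>lborel)"
proof -
  let ?G = "\<integral>\<^sup>+\<xi>. ennreal ((norm (g \<xi>))\<^sup>2) \<partial>lborel"
  let ?V = "ennreal (measure lborel (cball (0::'a) r))"
  have V: "emeasure lborel (cball (0::'a) r) = ?V"
    using emeasure_lborel_cball_finite [of "0::'a" r] by (intro emeasure_eq_ennreal_measure) (simp add: less_top)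
  have B: "emeasure lborel (ball z 1) = ennreal (measure lborel (ball z 1))"
    using emeasure_lborel_ball_finite [of z 1] by (intro emeasure_eq_ennreal_measure) (simp add: less_top)
  have pt: "ennreal ((norm (osc p g t x))\<^sup>2) \<le> ?V * ?G" for t x
  proof -
    have "ennreal (norm (osc p g t x)) \<le> (\<integral>\<^sup>+\<xi>. ennreal (norm (cis (x \<bullet> \<xi> + t * p \<xi>) * g \<xi>)) \<partial>lborel)"
      unfolding osc_def by (rule integral_norm_bound_ennreal')
    also have "\<dots> = (\<integral>\<^sup>+\<xi>. indicator (cball 0 r) \<xi> * ennreal (norm (g \<xi>)) \<partial>lborel)"
      using supp by (intro nn_integral_cong) (auto simp: norm_mult indicator_def)
    finally have "(ennreal (norm (osc p g t x)))\<^sup>2 \<le> (\<integral>\<^sup>+\<xi>. indicator (cball 0 r) \<xi> * ennreal (norm (g \<xi>)) \<partial>lborel)\<^sup>2"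
      by (rule power_mono) simp
    also have "\<dots> \<le> (\<integral>\<^sup>+\<xi>. (indicator (cball (0::'a) r) \<xi>)\<^sup>2 \<partial>lborel) * (\<integral>\<^sup>+\<xi>. (ennreal (norm (g \<xi>)))\<^sup>2 \<partial>lborel)"
      by (rule Cauchy_Schwarz_nn_integral [where f = "indicator (cball (0::'a) r)" and M = lborel
            and g = "\<lambda>\<xi>. ennreal (norm (g \<xi>))"]) (auto intro: borel_measurable_indicator)
    also have "(\<integral>\<^sup>+\<xi>. (indicator (cball (0::'a) r) \<xi>)\<^sup>2 \<partial>lborel) = (\<integral>\<^sup>+\<xi>. indicator (cball (0::'a) r) \<xi> \<partial>lborel)"
      by (intro nn_integral_cong) (auto simp: indicator_def)
    finally show ?thesis
      by (simp add: ennreal_power V)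
  qed
  have "(\<integral>\<^sup>+t\<in>A. (\<integral>\<^sup>+x\<in>ball z 1. ennreal ((norm (osc p g t x))\<^sup>2) \<partial>lborel) \<partial>lborel)
    \<le> (\<integral>\<^sup>+t\<in>A. (\<integral>\<^sup>+x\<in>ball z 1. ?V * ?G \<partial>lborel) \<partial>lborel)"
    by (intro nn_integral_mono mult_right_mono pt) auto
  also have "\<dots> = ?V * ?G * emeasure lborel (ball z 1) * emeasure lborel A"
    using A by (simp add: nn_integral_cmult_indicator)
  also have "\<dots> \<le> ?V * ?G * emeasure lborel (ball z 1) * ennreal 3"
    using emeasure_mono [OF A(2), of lborel] by (intro mult_left_mono) auto
  also have "\<dots> = ennreal (3 * measure lborel (ball z 1) * measure lborel (cball (0::'a) r)) * ?G"
    unfolding B by (simp add: ennreal_mult mult_ac)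
  finally show ?thesis .
qed

section \<open>Frequency supports and Sobolev weights of the Littlewood-Paley pieces\<close>

lemma littlewood_paley_continuous:
  assumes "littlewood_paley \<psi>"
  shows "continuous_on UNIV \<psi>"
proof -
  have "\<psi> differentiable (at x)" for x
    using assms by (auto simp: littlewood_paley_def smooth_def dest!: spec [of _ "[]"])
  then show ?thesis
    by (simp add: continuous_at_imp_continuous_on differentiable_imp_continuous_within)
qed

lemma littlewood_paley_support:
  assumes "littlewood_paley \<psi>" "\<psi> \<rho> \<noteq> 0"
  shows "1 / 4 < \<rho>" "\<rho> < 2"
proof -
  have "\<rho> \<in> closure {\<rho>. \<psi> \<rho> \<noteq> 0}"
    using assms(2) by (intro subsetD [OF closure_subset]) auto
  then have "\<rho> \<in> {1 / 4<..<2}"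
    using assms(1) by (auto simp: littlewood_paley_def)
  then show "1 / 4 < \<rho>" "\<rho> < 2"
    by auto
qed

lemma littlewood_paley_bounded:
  assumes "littlewood_paley \<psi>"
  shows "\<exists>B\<ge>0. \<forall>\<rho>. norm (\<psi> \<rho>) \<le> B"
proof -
  have "bounded (\<psi> ` {1 / 4..2})"
    by (intro compact_imp_bounded compact_continuous_image
        continuous_on_subset [OF littlewood_paley_continuous [OF assms]]) auto
  then obtain B where B: "\<And>\<rho>. \<rho> \<in> {1 / 4..2} \<Longrightarrow> norm (\<psi> \<rho>) \<le> B"
    unfolding bounded_iff by blast
  have "norm (\<psi> \<rho>) \<le> max 0 B" for \<rho>
    using B [of \<rho>] littlewood_paley_support [OF assms, of \<rho>] by (cases "\<psi> \<rho> = 0") auto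
  then show ?thesis
    by (intro exI [of _ "max 0 B"]) auto
qed

lemma P_hat_support:
  assumes \<psi>: "littlewood_paley \<psi>" and "P_hat \<psi> j u \<xi> \<noteq> 0"
  shows "2 powr of_int j / 4 < norm \<xi>" "norm \<xi> < 2 * 2 powr of_int j"
proof -
  have "\<psi> (2 powr (- of_int j) * norm \<xi>) \<noteq> 0"
    using assms by (auto simp: P_hat_def)
  from littlewood_paley_support [OF \<psi> this]
  show "2 powr of_int j / 4 < norm \<xi>" "norm \<xi> < 2 * 2 powr of_int j"
    by (simp_all add: powr_minus field_simps)
qed

text \<open>Only \<open>P\<^sub>1\<close> and \<open>P\<^sub>2\<close> overlap the frequencies \<open>\<bar>\<xi>\<bar> < 2\<close>, and beyond these the \<open>P\<^sub>j\<close> with \<open>j \<ge> 1\<close>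
  already sum to the identity.\<close>

lemma P_le0_hat_eq:
  assumes \<psi>: "littlewood_paley \<psi>"
  shows "P_le0_hat \<psi> u \<xi> = (if norm \<xi> < 2 then
    (1 - \<psi> (norm \<xi> / 2) - \<psi> (norm \<xi> / 4)) * fourier_fun u \<xi> else 0)"
proof (cases "norm \<xi> < 2")
  case True
  have z: "P_hat \<psi> j u \<xi> = 0" if "3 \<le> j" for j
  proof (rule ccontr)
    assume "P_hat \<psi> j u \<xi> \<noteq> 0"
    then have "2 powr of_int j / 4 < norm \<xi>"
      by (rule P_hat_support [OF \<psi>])
    moreover have "2 powr 3 \<le> (2::real) powr of_int j"
      using that by (intro powr_mono) auto
    ultimately show False
      using True by simp
  qed
  have "(\<Sum>\<^sub>\<infinity>j\<in>{1..}. P_hat \<psi> j u \<xi>) = (\<Sum>\<^sub>\<infinity>j\<in>{1, 2}. P_hat \<psi> j u \<xi>)"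
    by (intro infsum_cong_neutral) (auto intro!: z)
  also have "\<dots> = P_hat \<psi> 1 u \<xi> + P_hat \<psi> 2 u \<xi>"
    by simp
  finally show ?thesis
    using True by (simp add: P_le0_hat_def P_hat_def algebra_simps powr_minus)
next
  case False
  have z: "P_hat \<psi> j u \<xi> = 0" if "j < 1" for j
  proof (rule ccontr)
    assume "P_hat \<psi> j u \<xi> \<noteq> 0"
    then have "norm \<xi> < 2 * 2 powr of_int j"
      by (rule P_hat_support [OF \<psi>])
    moreover have "(2::real) powr of_int j \<le> 2 powr 0"
      using that by (intro powr_mono) auto
    ultimately show False
      using False by simp
  qed
  have "0 < norm \<xi>"
    using False by linarith
  then have "((\<lambda>j::int. \<psi> (2 powr (- of_int j) * norm \<xi>)) has_sum 1) UNIV"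
    using \<psi> by (auto simp: littlewood_paley_def)
  then have "((\<lambda>j. P_hat \<psi> j u \<xi>) has_sum (1 * fourier_fun u \<xi>)) UNIV"
    unfolding P_hat_def by (rule has_sum_cmult_left)
  then have "(\<Sum>\<^sub>\<infinity>j. P_hat \<psi> j u \<xi>) = fourier_fun u \<xi>"
    by (simp add: infsumI)
  moreover have "(\<Sum>\<^sub>\<infinity>j\<in>{1..}. P_hat \<psi> j u \<xi>) = (\<Sum>\<^sub>\<infinity>j. P_hat \<psi> j u \<xi>)"
    by (intro infsum_cong_neutral) (auto intro!: z)
  ultimately show ?thesis
    using False by (simp add: P_le0_hat_def)
qed

text \<open>The ratio of \<open>q\<close> to \<open>\<Lambda>\<^sup>2\<close> lies between 1/16 and
  16, so its power \<open>s\<close> is at least \<open>16 powr (- \<bar>s\<bar>)\<close> for either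
  sign of \<open>s\<close>.\<close>

lemma powr_weight_lower:
  fixes q \<Lambda> s :: real
  assumes "0 < \<Lambda>" "\<Lambda>\<^sup>2 / 16 \<le> q" "q \<le> 16 * \<Lambda>\<^sup>2"
  shows "1 \<le> 16 powr \<bar>s\<bar> * \<Lambda> powr (- 2 * s) * q powr s"
proof -
  define y where "y = q / \<Lambda>\<^sup>2"
  have y: "1 / 16 \<le> y" "y \<le> 16" "q = y * \<Lambda>\<^sup>2"
    using assms by (auto simp: y_def field_simps)
  have "16 powr (- \<bar>s\<bar>) \<le> y powr s"
  proof (cases "0 \<le> s")
    case True
    then have "(1 / 16) powr s \<le> y powr s"
      using y by (intro powr_mono2) auto
    then show ?thesis
      using True by (simp add: powr_minus_divide powr_divide)
  next
    case False
    then have "16 powr s \<le> y powr s"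
      using y by (intro powr_mono2') auto
    then show ?thesis
      using False by simp
  qed
  then have "16 powr \<bar>s\<bar> * 16 powr (- \<bar>s\<bar>) \<le> 16 powr \<bar>s\<bar> * y powr s"
    by (intro mult_left_mono) auto
  then have "1 \<le> 16 powr \<bar>s\<bar> * y powr s"
    by (simp add: powr_add [symmetric])
  also have "y powr s = \<Lambda> powr (- 2 * s) * q powr s"
  proof -
    have "\<Lambda> powr (- 2 * s) * q powr s = y powr s * (\<Lambda> powr (- 2 * s) * (\<Lambda>\<^sup>2) powr s)"
      unfolding y(3) using y assms by (subst powr_mult) auto
    also have "(\<Lambda>\<^sup>2) powr s = \<Lambda> powr (2 * s)"
      using assms powr_powr [of \<Lambda> 2 s] by simp
    also have "\<Lambda> powr (- 2 * s) * \<Lambda> powr (2 * s) = 1"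
      using assms by (simp add: powr_add [symmetric])
    finally show ?thesis
      by simp
  qed
  finally show ?thesis
    by (simp add: mult.assoc)
qed

text \<open>This trades the Sobolev weight for a power of the frequency scale. It is applied with
  the dyadic scale to the high frequencies and with scale 1 to the low ones.\<close>

lemma nn_integral_square_le_weighted:
  fixes g u :: "'a::euclidean_space \<Rightarrow> complex"
  assumes B: "0 \<le> B" and g: "\<And>\<xi>. norm (g \<xi>) \<le> B * norm (u \<xi>)" and \<Lambda>: "0 < \<Lambda>"
    and supp: "\<And>\<xi>. g \<xi> \<noteq> 0 \<Longrightarrow> \<Lambda>\<^sup>2 / 16 \<le> 1 + (norm \<xi>)\<^sup>2 \<and> 1 + (norm \<xi>)\<^sup>2 \<le> 16 * \<Lambda>\<^sup>2"
    and [measurable]: "u \<in> borel_measurable borel"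
  shows "(\<integral>\<^sup>+\<xi>. ennreal ((norm (g \<xi>))\<^sup>2) \<partial>lborel) \<le>
    ennreal (B\<^sup>2 * 16 powr \<bar>s\<bar> * \<Lambda> powr (- 2 * s)) *
     (\<integral>\<^sup>+\<xi>. ennreal ((1 + (norm \<xi>)\<^sup>2) powr s * (norm (u \<xi>))\<^sup>2) \<partial>lborel)"
proof -
  have "(norm (g \<xi>))\<^sup>2 \<le> B\<^sup>2 * 16 powr \<bar>s\<bar> * \<Lambda> powr (- 2 * s) * ((1 + (norm \<xi>)\<^sup>2) powr s * (norm (u \<xi>))\<^sup>2)" for \<xi>
  proof (cases "g \<xi> = 0")
    case False
    have "1 \<le> 16 powr \<bar>s\<bar> * \<Lambda> powr (- 2 * s) * (1 + (norm \<xi>)\<^sup>2) powr s"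
      using supp [OF False] \<Lambda> by (intro powr_weight_lower) auto
    then have "1 * (B * norm (u \<xi>))\<^sup>2 \<le> 16 powr \<bar>s\<bar> * \<Lambda> powr (- 2 * s) * (1 + (norm \<xi>)\<^sup>2) powr s * (B * norm (u \<xi>))\<^sup>2"
      by (intro mult_right_mono) auto
    moreover have "(norm (g \<xi>))\<^sup>2 \<le> (B * norm (u \<xi>))\<^sup>2"
      by (intro power_mono g) simp
    ultimately show ?thesis
      by (simp add: power_mult_distrib mult_ac)
  qed simp
  then have "(\<integral>\<^sup>+\<xi>. ennreal ((norm (g \<xi>))\<^sup>2) \<partial>lborel) \<le>
     (\<integral>\<^sup>+\<xi>. ennreal (B\<^sup>2 * 16 powr \<bar>s\<bar> * \<Lambda> powr (- 2 * s)) *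
        ennreal ((1 + (norm \<xi>)\<^sup>2) powr s * (norm (u \<xi>))\<^sup>2) \<partial>lborel)"
    by (intro nn_integral_mono) (simp add: ennreal_mult' [symmetric] ennreal_leI)
  also have "\<dots> = ennreal (B\<^sup>2 * 16 powr \<bar>s\<bar> * \<Lambda> powr (- 2 * s)) *
     (\<integral>\<^sup>+\<xi>. ennreal ((1 + (norm \<xi>)\<^sup>2) powr s * (norm (u \<xi>))\<^sup>2) \<partial>lborel)"
    by (intro nn_integral_cmult) measurable
  finally show ?thesis .
qed

section \<open>Combination of the high- and low-frequency estimates\<close>

theorem theorem1p7:
  fixes \<gamma> \<alpha> s :: real and E :: "real set" and \<psi> :: "real \<Rightarrow> complex" and z :: "real ^ 'n"
  assumes "littlewood_paley \<psi>"
    and "\<gamma> > 1" and "0 < \<alpha>" and "\<alpha> \<le> 1"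
    and "E \<subseteq> {0..1}"
    and "assouad_char \<alpha> ((\<gamma> - 1) / \<gamma>) E < \<infinity>"
    and "s \<ge> (\<alpha> - \<gamma>) / 2"
  shows "\<exists>C::real. \<forall>f \<in> (sobolev_space s :: (real ^ 'n) distr set).
    (SUP j\<in>{1::int..}. mixed_norm (nbhd E (2 powr (- \<gamma> * of_int j))) (ball z 1)
        (\<lambda>t. propagator \<gamma> t (P_hat \<psi> j f)))
      + mixed_norm (nbhd E 1) (ball z 1) (\<lambda>t. propagator \<gamma> t (P_le0_hat \<psi> f))
    \<le> ennreal C * sobolev_norm s f"
proof -
  note \<psi> = assms(1) and \<gamma> = assms(2) and E = assms(5)
  have \<psi>_meas [measurable]: "\<psi> \<in> borel_measurable borel"
    by (rule borel_measurable_continuous_onI [OF littlewood_paley_continuous [OF \<psi>]])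
  obtain B where B: "0 \<le> B" "\<And>\<rho>. norm (\<psi> \<rho>) \<le> B"
    using littlewood_paley_bounded [OF \<psi>] by blast
  define K where "K = enn2real (assouad_char \<alpha> ((\<gamma> - 1) / \<gamma>) E)"
  have K: "assouad_char \<alpha> ((\<gamma> - 1) / \<gamma>) E \<le> ennreal K" "0 \<le> K"
    using assms(6) by (auto simp: K_def)
  let ?p = "\<lambda>\<xi>::real^'n. norm \<xi> powr \<gamma>"
  obtain C where C: "0 \<le> C" and est: "\<And>\<Lambda> A M g. 2 \<le> \<Lambda> \<Longrightarrow> A \<in> sets borel \<Longrightarrow> 0 \<le> M \<Longrightarrow> integrable lborel g \<Longrightarrow>
     (\<And>\<xi>. g \<xi> \<noteq> 0 \<Longrightarrow> \<Lambda> / 4 \<le> norm \<xi> \<and> norm \<xi> \<le> 2 * \<Lambda>) \<Longrightarrow>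
     (\<And>a. emeasure lborel (A \<inter> {a..a + \<Lambda> powr (1 - \<gamma>)}) \<le> ennreal M) \<Longrightarrow>
     (\<integral>\<^sup>+t\<in>A. (\<integral>\<^sup>+x\<in>ball z 1. ennreal ((norm (osc ?p g t x))\<^sup>2) \<partial>lborel) \<partial>lborel)
     \<le> ennreal (C * M) * (\<integral>\<^sup>+\<xi>. ennreal ((norm (g \<xi>))\<^sup>2) \<partial>lborel)"
    by (fact dispersive_neighbourhood_estimate [OF \<gamma>])
  \<comment> \<open>The factor \<open>12 * K\<close> is the measure bound for the neighbourhood of
    \<open>E\<close>; \<open>B\<^sup>2 * 16 powr \<bar>s\<bar>\<close> bounds the multiplier and the
    Sobolev weight.\<close>
  define C1 where "C1 = C * 12 * K * B\<^sup>2 * 16 powr \<bar>s\<bar>"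
  define C2 where "C2 = 3 * measure lborel (ball z 1) * measure lborel (cball (0::real^'n) 2) *
      ((1 + 2 * B)\<^sup>2 * 16 powr \<bar>s\<bar>)"
  have C12: "0 \<le> C1" "0 \<le> C2"
    using C K B by (auto simp: C1_def C2_def)
  show ?thesis
  \<comment> \<open>\<open>C1\<close> and \<open>C2\<close> are constants for squared norms, hence
    the roots.\<close>
  proof (intro exI [of _ "sqrt C1 + sqrt C2"] ballI)
    fix f :: "(real ^ 'n) distr"
    assume f: "f \<in> sobolev_space s"
    let ?u = "fourier_fun f"
    let ?W = "\<integral>\<^sup>+\<xi>. ennreal ((1 + (norm \<xi>)\<^sup>2) powr s * (norm (?u \<xi>))\<^sup>2) \<partial>lborel"
    \<comment> \<open>Existence of a representative makes the chosen \<open>fourier_fun f\<close> a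
      genuine, in particular measurable, one.\<close>
    have "\<exists>g. fourier_is_fun f g"
      using f by (simp add: sobolev_space_def)
    then have "fourier_is_fun f ?u"
      unfolding fourier_fun_def by (rule someI_ex)
    then have u [measurable]: "?u \<in> borel_measurable borel"
      by (simp add: fourier_is_fun_def)
    have N: "sobolev_norm s f = ennsqrt ?W"
      by (simp add: sobolev_norm_def)
    have W: "?W < \<infinity>"
      using f unfolding sobolev_space_def mem_Collect_eq N ennsqrt_less_top by blast
    have high: "mixed_norm (nbhd E (2 powr (- \<gamma> * of_int j))) (ball z 1) (\<lambda>t. propagator \<gamma> t (P_hat \<psi> j f))
        \<le> ennreal (sqrt C1) * sobolev_norm s f" if j: "j \<in> {1::int..}" for j
    proof -
      define \<Lambda> where "\<Lambda> = (2::real) powr of_int j"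
      have "2 powr 1 \<le> \<Lambda>"
        unfolding \<Lambda>_def using j by (intro powr_mono) auto
      then have \<Lambda>: "2 \<le> \<Lambda>"
        by simp
      have \<Lambda>\<gamma>: "2 powr (- \<gamma> * of_int j) = \<Lambda> powr (- \<gamma>)"
        by (simp add: \<Lambda>_def powr_powr mult.commute)
      let ?g = "P_hat \<psi> j f"
      have [measurable]: "?g \<in> borel_measurable borel"
        unfolding P_hat_def [abs_def] by measurable
      have supp: "\<Lambda> / 4 \<le> norm \<xi> \<and> norm \<xi> \<le> 2 * \<Lambda>" if "?g \<xi> \<noteq> 0" for \<xi>
        using P_hat_support [OF \<psi> that] by (simp add: \<Lambda>_def)
      have G: "(\<integral>\<^sup>+\<xi>. ennreal ((norm (?g \<xi>))\<^sup>2) \<partial>lborel) \<le>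
          ennreal (B\<^sup>2 * 16 powr \<bar>s\<bar> * \<Lambda> powr (- 2 * s)) * ?W"
      proof (rule nn_integral_square_le_weighted [OF B(1) _ _ _ u])
        show "norm (?g \<xi>) \<le> B * norm (?u \<xi>)" for \<xi>
          using B by (simp add: P_hat_def norm_mult mult_right_mono)
        show "\<Lambda>\<^sup>2 / 16 \<le> 1 + (norm \<xi>)\<^sup>2 \<and> 1 + (norm \<xi>)\<^sup>2 \<le> 16 * \<Lambda>\<^sup>2" if "?g \<xi> \<noteq> 0" for \<xi>
        proof -
          have "(\<Lambda> / 4)\<^sup>2 \<le> (norm \<xi>)\<^sup>2" "(norm \<xi>)\<^sup>2 \<le> (2 * \<Lambda>)\<^sup>2" "1\<^sup>2 \<le> \<Lambda>\<^sup>2"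
            using supp [OF that] \<Lambda> by (intro power_mono; simp)+
          then show ?thesis
            by (simp add: power_divide power_mult_distrib)
        qed
      qed (use \<Lambda> in simp)
      also have "\<dots> < \<infinity>"
        using W by (simp add: ennreal_mult_less_top)
      finally have g: "integrable lborel ?g"
        using supp by (intro integrable_of_square_integrable [of _ "2 * \<Lambda>"]) auto
      have "(\<integral>\<^sup>+t\<in>nbhd E (\<Lambda> powr (- \<gamma>)). (\<integral>\<^sup>+x\<in>ball z 1. ennreal ((norm (osc ?p ?g t x))\<^sup>2) \<partial>lborel) \<partial>lborel)
         \<le> ennreal (C * (12 * K * \<Lambda> powr (\<alpha> - \<gamma>))) * (\<integral>\<^sup>+\<xi>. ennreal ((norm (?g \<xi>))\<^sup>2) \<partial>lborel)"
      proof (rule est [OF \<Lambda> _ _ g])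
        show "emeasure lborel (nbhd E (\<Lambda> powr (- \<gamma>)) \<inter> {a..a + \<Lambda> powr (1 - \<gamma>)})
            \<le> ennreal (12 * K * \<Lambda> powr (\<alpha> - \<gamma>))" for a
          by (rule emeasure_nbhd_Int_le [OF E \<gamma> \<Lambda> K])
      qed (use supp K in auto)
      also have "\<dots> \<le> ennreal (C * (12 * K * \<Lambda> powr (\<alpha> - \<gamma>))) * (ennreal (B\<^sup>2 * 16 powr \<bar>s\<bar> * \<Lambda> powr (- 2 * s)) * ?W)"
        by (intro mult_left_mono G) simp
      also have "\<dots> = ennreal (C1 * \<Lambda> powr (\<alpha> - \<gamma> - 2 * s)) * ?W"
      proof -
        have "\<Lambda> powr (\<alpha> - \<gamma> - 2 * s) = \<Lambda> powr (\<alpha> - \<gamma>) * \<Lambda> powr (- 2 * s)"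
          using \<Lambda> by (simp add: powr_add [symmetric])
        then have "C * (12 * K * \<Lambda> powr (\<alpha> - \<gamma>)) * (B\<^sup>2 * 16 powr \<bar>s\<bar> * \<Lambda> powr (- 2 * s))
            = C1 * \<Lambda> powr (\<alpha> - \<gamma> - 2 * s)"
          by (simp only: C1_def mult_ac)
        then show ?thesis
          using C K by (subst ennreal_mult_mult) auto
      qed
      also have "\<dots> \<le> ennreal C1 * ?W"
      proof (intro mult_right_mono ennreal_leI)
        \<comment> \<open>Here the threshold for \<open>s\<close> enters: it makes the exponent
          nonpositive, so the bound is uniform in \<open>j\<close>.\<close>
        have "\<Lambda> powr (\<alpha> - \<gamma> - 2 * s) \<le> \<Lambda> powr 0"
          using assms(7) \<Lambda> by (intro powr_mono) auto
        then show "C1 * \<Lambda> powr (\<alpha> - \<gamma> - 2 * s) \<le> C1"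
          using C12 \<Lambda> by (intro mult_left_le) auto
      qed simp
      finally have "mixed_norm (nbhd E (\<Lambda> powr (- \<gamma>))) (ball z 1) (\<lambda>t. propagator \<gamma> t ?g) \<le> ennsqrt (ennreal C1 * ?W)"
        by (rule mixed_norm_le [OF norm_propagator_le])
      then show ?thesis
        unfolding \<Lambda>\<gamma> N using C12 W by (simp add: ennsqrt_mult_left)
    qed
    have low: "mixed_norm (nbhd E 1) (ball z 1) (\<lambda>t. propagator \<gamma> t (P_le0_hat \<psi> f))
        \<le> ennreal (sqrt C2) * sobolev_norm s f"
    proof -
      let ?g = "P_le0_hat \<psi> f"
      have [measurable]: "?g \<in> borel_measurable borel"
        unfolding P_le0_hat_eq [OF \<psi>, abs_def] by measurable
      have supp: "norm \<xi> < 2" if "?g \<xi> \<noteq> 0" for \<xi>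
        using that by (auto simp: P_le0_hat_eq [OF \<psi>] split: if_splits)
      \<comment> \<open>This interval of length 3 is the one assumed in
        \<open>low_frequency_estimate\<close>.\<close>
      have A: "nbhd E 1 \<subseteq> {-1..2}"
        using E by (fastforce dest!: nbhd_memD)
      have "(\<integral>\<^sup>+\<xi>. ennreal ((norm (?g \<xi>))\<^sup>2) \<partial>lborel) \<le>
          ennreal ((1 + 2 * B)\<^sup>2 * 16 powr \<bar>s\<bar> * 1 powr (- 2 * s)) * ?W"
      proof (rule nn_integral_square_le_weighted [OF _ _ _ _ u])
        show "norm (?g \<xi>) \<le> (1 + 2 * B) * norm (?u \<xi>)" for \<xi>
        proof -
          \<comment> \<open>Below frequency 2 only two pieces are subtracted from the identity,
            which gives \<open>1 + 2 * B\<close>.\<close>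
          have "norm (1 - \<psi> (norm \<xi> / 2) - \<psi> (norm \<xi> / 4)) \<le> norm (1 - \<psi> (norm \<xi> / 2)) + norm (\<psi> (norm \<xi> / 4))"
            by (rule norm_triangle_ineq4)
          also have "norm (1 - \<psi> (norm \<xi> / 2)) \<le> norm (1::complex) + norm (\<psi> (norm \<xi> / 2))"
            by (rule norm_triangle_ineq4)
          finally have "norm (1 - \<psi> (norm \<xi> / 2) - \<psi> (norm \<xi> / 4)) \<le> 1 + 2 * B"
            using B(2) [of "norm \<xi> / 2"] B(2) [of "norm \<xi> / 4"] by simp
          then show ?thesis
            using B by (auto simp: P_le0_hat_eq [OF \<psi>] norm_mult intro!: mult_right_mono)
        qed
        show "1\<^sup>2 / 16 \<le> 1 + (norm \<xi>)\<^sup>2 \<and> 1 + (norm \<xi>)\<^sup>2 \<le> 16 * 1\<^sup>2" if "?g \<xi> \<noteq> 0" for \<xi>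
        proof -
          have "(norm \<xi>)\<^sup>2 \<le> 2\<^sup>2"
            using supp [OF that] by (intro power_mono) auto
          then show ?thesis
            by (simp add: add_increasing2)
        qed
      qed (use B in auto)
      then have G: "(\<integral>\<^sup>+\<xi>. ennreal ((norm (?g \<xi>))\<^sup>2) \<partial>lborel) \<le> ennreal ((1 + 2 * B)\<^sup>2 * 16 powr \<bar>s\<bar>) * ?W"
        by simp
      have "(\<integral>\<^sup>+t\<in>nbhd E 1. (\<integral>\<^sup>+x\<in>ball z 1. ennreal ((norm (osc ?p ?g t x))\<^sup>2) \<partial>lborel) \<partial>lborel)
         \<le> ennreal (3 * measure lborel (ball z 1) * measure lborel (cball (0::real^'n) 2)) *
            (\<integral>\<^sup>+\<xi>. ennreal ((norm (?g \<xi>))\<^sup>2) \<partial>lborel)"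
        using supp by (intro low_frequency_estimate A) (auto simp: less_imp_le)
      also have "\<dots> \<le> ennreal (3 * measure lborel (ball z 1) * measure lborel (cball (0::real^'n) 2)) *
            (ennreal ((1 + 2 * B)\<^sup>2 * 16 powr \<bar>s\<bar>) * ?W)"
        by (intro mult_left_mono G) simp
      also have "\<dots> = ennreal C2 * ?W"
        unfolding C2_def by (rule ennreal_mult_mult) simp
      finally have "mixed_norm (nbhd E 1) (ball z 1) (\<lambda>t. propagator \<gamma> t ?g) \<le> ennsqrt (ennreal C2 * ?W)"
        by (rule mixed_norm_le [OF norm_propagator_le])
      then show ?thesis
        unfolding N using C12 W by (simp add: ennsqrt_mult_left)
    qed
    have "(SUP j\<in>{1::int..}. mixed_norm (nbhd E (2 powr (- \<gamma> * of_int j))) (ball z 1)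
        (\<lambda>t. propagator \<gamma> t (P_hat \<psi> j f))) \<le> ennreal (sqrt C1) * sobolev_norm s f"
      by (intro SUP_least high)
    then show "(SUP j\<in>{1::int..}. mixed_norm (nbhd E (2 powr (- \<gamma> * of_int j))) (ball z 1)
        (\<lambda>t. propagator \<gamma> t (P_hat \<psi> j f)))
      + mixed_norm (nbhd E 1) (ball z 1) (\<lambda>t. propagator \<gamma> t (P_le0_hat \<psi> f))
    \<le> ennreal (sqrt C1 + sqrt C2) * sobolev_norm s f"
      unfolding ennreal_plus [OF real_sqrt_ge_zero [OF C12(1)] real_sqrt_ge_zero [OF C12(2)]] distrib_right
      using low by (rule add_mono)
  qed
qed

end
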